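(* Let $m,n,r,s,t$ be positive integers with $1 \leq t \leq r \leq s$, and let $u$ be a non-negative real number such that $u > \frac{6-t}{3}$. Suppose $\min\{m,n\} \geq (t+u+2)(s-t)+r-1$. If $\mathcal{A} \subseteq \binom{[m]}{r}$, $\mathcal{B} \subseteq \binom{[n]}{s}$, and $\mathcal{A}$ and $\mathcal{B}$ are cross-$t$-intersecting, then \[|\mathcal{A}||\mathcal{B}| \leq \binom{m-t}{r-t}\binom{n-t}{s-t}.\] Moreover, if $u > 0$, then the bound is attained if and only if $\mathcal{A} = \left\{ A \in \binom{[m]}{r} : T \subseteq A \right\}$ and $\mathcal{B} = \left\{ B \in \binom{[n]}{s} : T \subseteq B \right\}$ for some $t$-element subset $T$ of $[\min\{m,n\}]$.
   Context: For a positive integer $n$, $[n]=\{1,2,\dots,n\}$. For a set $X$, $\binom{X}{r}$ denotes the family of all $r$-element subsets of $X$. Two families $\mathcal{A}$ and $\mathcal{B}$ of sets (possibly empty, not necessarily distinct) are cross-$t$-intersecting if $|A \cap B| \geq t$ for every $A \in \mathcal{A}$ and every $B \in \mathcal{B}$. For numerical binomial coefficients, the usual convention $\binom{a}{0}=1$ for every integer $a$ is used. *)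

theory Defs
  imports Complex_Main "HOL-Library.Ramsey"
begin

text \<open>
  The family of \<open>r\<close>-element subsets of \<open>X\<close> is the library's \<open>nsets X r\<close>, written
  \<open>[X]\<^bsup>r\<^esup>\<close>. The definition below is meant for families of finite sets
  (\<open>card\<close> of an infinite set is \<open>0\<close>).
\<close>

definition cross_intersecting :: "nat \<Rightarrow> 'a set set \<Rightarrow> 'a set set \<Rightarrow> bool"
  where "cross_intersecting t \<A> \<B> \<longleftrightarrow> (\<forall>A\<in>\<A>. \<forall>B\<in>\<B>. card (A \<inter> B) \<ge> t)"

text \<open>
  Binomial coefficients such as \<open>(m - t) choose (r - t)\<close> are taken over the natural numbers.
  If \<open>t \<le> r \<le> s\<close>, \<open>u \<ge> 0\<close> and \<open>m \<ge> (t + u + 2)(s - t) + r - 1\<close>, then \<open>m < t\<close> is possible only for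
  \<open>r = s = t\<close> and \<open>m = t - 1\<close>. There the truncated \<open>m - t\<close> yields \<open>0 choose 0 = 1\<close>, in agreement
  with the convention that \<open>a\<close> over \<open>0\<close> is \<open>1\<close> for every integer \<open>a\<close>; the same holds for \<open>n\<close>.
\<close>

end

theory Submission
  imports Defs
begin

text \<open>
  Take a pair \<open>(\<A>, \<B>)\<close> for which \<open>|\<A>||\<B>|\<close> is maximum. Replacing \<open>j\<close> by a smaller \<open>i\<close> wherever
  possible keeps sizes and the cross-\<open>t\<close>-intersection property, so after finitely many such
  compressions the pair is left-shifted and still of maximum product. In a left-shifted pair, any
  \<open>X \<in> \<A>\<close> and \<open>Y \<in> \<B>\<close> already share \<open>t\<close> elements inside the prefix \<open>{1..r + s - t}\<close>
  (\<open>left_shifted_prefix_cross\<close>). The core of the proof, \<open>prefix_cross_pred\<close>, lowers the length \<open>l\<close>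
  of such a prefix by one as long as \<open>l > t\<close>; at \<open>l = t\<close> every member of \<open>\<A>\<close> and \<open>\<B>\<close> contains
  \<open>{1..t}\<close>, and counting finishes the proof.

  For one descent step suppose that \<open>l\<close> cannot be lowered. By maximality, membership in \<open>\<A>\<close> and \<open>\<B>\<close>
  depends only on the trace on \<open>{1..l}\<close>, and there are traces \<open>S \<union> {l}\<close> of \<open>\<A>\<close> and \<open>R \<union> {l}\<close>
  of \<open>\<B>\<close> with \<open>|S \<inter> R| = t - 1\<close>. Shiftedness forces \<open>S \<union> R = {1..<l}\<close>, so a conflicting pair has
  sizes \<open>i = |S|\<close>, \<open>j = |R|\<close> with \<open>i + j = l + t - 2\<close>. Call these \<open>S\<close> of size \<open>i\<close> and \<open>R\<close> of size \<open>j\<close>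
  pivots. One may delete \<open>l\<close> from some pivotal traces of \<open>\<A>\<close>, provided that the remaining pivotal
  traces, and those of \<open>\<B>\<close> that would conflict, are discarded (\<open>exchange_prefix_cross\<close>). Deleting \<open>l\<close>
  from a trace with more than \<open>t\<close> elements multiplies the number of sets having that trace by at
  least \<open>L = t + u\<close>
  (\<open>class_ratio\<close>); this is what the lower bound on \<open>m\<close> and \<open>n\<close> provides.

  Let \<open>x\<close> and \<open>y\<close> count the members of \<open>\<A>\<close> and \<open>\<B>\<close> with pivotal traces. If \<open>i, j \<ge> t\<close>, maximality
  against the two one-sided exchanges gives \<open>x \<ge> (1 - 1 / L)|\<A>|\<close> and \<open>y \<ge> (1 - 1 / L)|\<B>|\<close>
  (\<open>exchange_balance\<close>). On the other hand, shifting \<open>l\<close> downwards produces many nonpivotal members, so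
  \<open>x \<le> |\<A>|(i + 1) / l\<close> and \<open>y \<le> |\<B>|(j + 1) / l\<close> (\<open>pivot_fraction\<close>). The condition \<open>u > (6 - t) / 3\<close>
  says \<open>L > 2 + 2t / 3\<close>, and this is just enough to leave only \<open>i = j = t\<close> and \<open>l = t + 2\<close>. There the
  pivots are \<open>t\<close>-subsets of a \<open>(t + 1)\<close>-set, and both sides have so many of them that some \<open>Z\<close> is a
  pivot on both; keeping only \<open>Z\<close> and deleting \<open>l\<close> from it enlarges both families. If \<open>i\<close> or \<open>j\<close> is
  \<open>t - 1\<close>, one family consists of all sets containing \<open>{1..l}\<close>, and a single exchange suffices
  (\<open>degenerate_pivot_impossible\<close>).

  All these gains are strict when \<open>L > t\<close>. When \<open>L = t\<close>, they can be ties, but then the exchanged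
  pair consists of families of sets that all contain a fixed \<open>t\<close>-set, hence satisfies the bound;
  so the step works for \<open>L = t\<close> under the assumption that the bound is violated, which is all the
  inequality needs. For the characterisation of equality the compressions must be undone:
  if a compressed pair consists of two stars with the same centre, so did the pair before
  (\<open>unshift_common_kernel\<close>).
\<close>

section \<open>Families with prescribed traces\<close>

definition cylinder :: "'a set \<Rightarrow> nat \<Rightarrow> 'a set \<Rightarrow> 'a set set \<Rightarrow> 'a set set"
  where "cylinder V r L \<S> = {X \<in> [V]\<^bsup>r\<^esup>. X \<inter> L \<in> \<S>}"

lemma finite_cylinder: "finite V \<Longrightarrow> finite (cylinder V r L \<S>)"
  by (rule finite_subset[of _ "[V]\<^bsup>r\<^esup>"]) (auto simp: cylinder_def finite_imp_finite_nsets)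

text \<open>
  A set with trace \<open>S\<close> on \<open>L\<close> is \<open>S\<close> together with an arbitrary set outside \<open>L\<close>, whose size is known
  because all prescribed traces have the same size.
\<close>
lemma card_cylinder:
  assumes V: "finite V" "L \<subseteq> V" and S: "\<S> \<subseteq> [L]\<^bsup>k\<^esup>" and "k \<le> r"
  shows "card (cylinder V r L \<S>) = card \<S> * ((card V - card L) choose (r - k))"
proof -
  have finL: "finite L" using V by (rule finite_subset[rotated])
  have "bij_betw (\<lambda>(S, R). S \<union> R) (\<S> \<times> [V - L]\<^bsup>(r - k)\<^esup>) (cylinder V r L \<S>)"
  proof (rule bij_betwI[where g = "\<lambda>X. (X \<inter> L, X - L)"])
    show "(\<lambda>(S, R). S \<union> R) \<in> \<S> \<times> [V - L]\<^bsup>(r - k)\<^esup> \<rightarrow> cylinder V r L \<S>"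
    proof clarify
      fix S R assume SR: "S \<in> \<S>" "R \<in> [V - L]\<^bsup>(r - k)\<^esup>"
      have S': "S \<subseteq> L" "finite S" "card S = k" using SR(1) S by (auto simp: nsets_def)
      have R': "R \<subseteq> V - L" "finite R" "card R = r - k" using SR(2) by (auto simp: nsets_def)
      have "S \<inter> R = {}" "(S \<union> R) \<inter> L = S" using S' R' by auto
      then show "S \<union> R \<in> cylinder V r L \<S>"
        using S' R' V SR(1) \<open>k \<le> r\<close>
        by (auto simp: cylinder_def nsets_def card_Un_disjoint)
    qed
    show "(\<lambda>X. (X \<inter> L, X - L)) \<in> cylinder V r L \<S> \<rightarrow> \<S> \<times> [V - L]\<^bsup>(r - k)\<^esup>"
    proof
      fix X assume X: "X \<in> cylinder V r L \<S>"
      then have "X \<inter> L \<in> \<S>" "finite X" "card X = r" "X \<subseteq> V" by (auto simp: cylinder_def nsets_def)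
      moreover from this have "card (X \<inter> L) = k" using S by (auto simp: nsets_def)
      ultimately show "(X \<inter> L, X - L) \<in> \<S> \<times> [V - L]\<^bsup>(r - k)\<^esup>"
        using card_Diff_subset_Int[of X L] finL by (auto simp: nsets_def)
    qed
  qed (use S in \<open>auto simp: nsets_def cylinder_def\<close>)
  then have "card (cylinder V r L \<S>) = card (\<S> \<times> [V - L]\<^bsup>(r - k)\<^esup>)"
    by (simp add: bij_betw_same_card)
  also have "\<dots> = card \<S> * ((card V - card L) choose (r - k))"
    using card_Diff_subset[OF finL V(2)] by (simp add: card_cartesian_product)
  finally show ?thesis .
qed

lemma card_star:
  assumes "finite V" "T \<subseteq> V" "card T \<le> r"
  shows "card {X \<in> [V]\<^bsup>r\<^esup>. T \<subseteq> X} = (card V - card T) choose (r - card T)"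
proof -
  have "{X \<in> [V]\<^bsup>r\<^esup>. T \<subseteq> X} = cylinder V r T {T}" by (auto simp: cylinder_def)
  then show ?thesis
    using card_cylinder[of V T "{T}" "card T" r] assms finite_subset[OF assms(2,1)]
    by (simp add: nsets_def)
qed

section \<open>Pairs of maximum product and prefixes\<close>

definition max_pair ::
  "nat \<Rightarrow> nat \<Rightarrow> nat \<Rightarrow> nat \<Rightarrow> nat \<Rightarrow> nat set set \<Rightarrow> nat set set \<Rightarrow> bool"
  where "max_pair t m r n s \<A> \<B> \<longleftrightarrow>
    \<A> \<subseteq> [{1..m}]\<^bsup>r\<^esup> \<and> \<B> \<subseteq> [{1..n}]\<^bsup>s\<^esup> \<and> cross_intersecting t \<A> \<B> \<and>
    (\<forall>\<A>' \<B>'. \<A>' \<subseteq> [{1..m}]\<^bsup>r\<^esup> \<longrightarrow> \<B>' \<subseteq> [{1..n}]\<^bsup>s\<^esup> \<longrightarrow> cross_intersecting t \<A>' \<B>' \<longrightarrow>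
       card \<A>' * card \<B>' \<le> card \<A> * card \<B>)"

definition left_shifted :: "nat set set \<Rightarrow> bool"
  where "left_shifted \<A> \<longleftrightarrow>
    (\<forall>X\<in>\<A>. \<forall>j\<in>X. \<forall>i. 1 \<le> i \<longrightarrow> i < j \<longrightarrow> i \<notin> X \<longrightarrow> insert i (X - {j}) \<in> \<A>)"

definition prefix_cross :: "nat \<Rightarrow> nat \<Rightarrow> nat set set \<Rightarrow> nat set set \<Rightarrow> bool"
  where "prefix_cross t l \<A> \<B> \<longleftrightarrow> (\<forall>X\<in>\<A>. \<forall>Y\<in>\<B>. t \<le> card (X \<inter> Y \<inter> {1..l}))"

lemma cross_intersecting_commute: "cross_intersecting t \<A> \<B> \<Longrightarrow> cross_intersecting t \<B> \<A>"
  unfolding cross_intersecting_def by (metis Int_commute)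

lemma max_pair_commute: "max_pair t m r n s \<A> \<B> \<Longrightarrow> max_pair t n s m r \<B> \<A>"
  unfolding max_pair_def by (metis cross_intersecting_commute mult.commute)

lemma prefix_cross_commute: "prefix_cross t l \<A> \<B> \<Longrightarrow> prefix_cross t l \<B> \<A>"
  unfolding prefix_cross_def by (metis Int_commute)

lemma max_pair_maximal:
  assumes "max_pair t m r n s \<A> \<B>" "\<A>' \<subseteq> [{1..m}]\<^bsup>r\<^esup>" "\<B>' \<subseteq> [{1..n}]\<^bsup>s\<^esup>" "cross_intersecting t \<A>' \<B>'"
  shows "card \<A>' * card \<B>' \<le> card \<A> * card \<B>"
  using assms unfolding max_pair_def by blast

lemma finite_family: "\<A> \<subseteq> [{1..m::nat}]\<^bsup>r\<^esup> \<Longrightarrow> finite \<A>"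
  using finite_imp_finite_nsets[of "{1..m}" r] finite_subset by blast

lemma max_pair_finite:
  assumes "max_pair t m r n s \<A> \<B>"
  shows "finite \<A>" "finite \<B>"
  using assms finite_family unfolding max_pair_def by blast+

lemma prefix_cross_imp_cross:
  assumes "prefix_cross t l \<A> \<B>" "\<A> \<subseteq> [V]\<^bsup>r\<^esup>"
  shows "cross_intersecting t \<A> \<B>"
  unfolding cross_intersecting_def
proof (intro ballI)
  fix X Y assume XY: "X \<in> \<A>" "Y \<in> \<B>"
  have "finite (X \<inter> Y)" using XY assms(2) by (auto simp: nsets_def)
  then have "card (X \<inter> Y \<inter> {1..l}) \<le> card (X \<inter> Y)" by (rule card_mono) blast
  moreover have "t \<le> card (X \<inter> Y \<inter> {1..l})" using assms(1) XY unfolding prefix_cross_def by blast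
  ultimately show "t \<le> card (X \<inter> Y)" by linarith
qed

text \<open>
  If \<open>X\<close> and \<open>Y\<close> share fewer than \<open>t\<close> elements of the prefix, then they share some \<open>z\<close> beyond it, and
  since \<open>|X \<union> Y| \<le> r + s - t\<close> some \<open>w\<close> of the prefix is missed by both. Shifting \<open>z\<close> to \<open>w\<close> in \<open>X\<close>
  loses a common element without changing the intersection inside the prefix; repeating this ends
  with a pair whose whole intersection is too small.
\<close>
lemma left_shifted_prefix_cross:
  assumes sh: "left_shifted \<A>" and A: "\<A> \<subseteq> [{1..m}]\<^bsup>r\<^esup>" and B: "\<B> \<subseteq> [{1..n}]\<^bsup>s\<^esup>"
    and cr: "cross_intersecting t \<A> \<B>"
  shows "prefix_cross t (r + s - t) \<A> \<B>"
proof -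
  define N where "N = r + s - t"
  have "X \<in> \<A> \<Longrightarrow> t \<le> card (X \<inter> Y \<inter> {1..N})" if Y: "Y \<in> \<B>" for X Y
  proof (induction "card (X \<inter> Y - {1..N})" arbitrary: X)
    case 0
    then have X: "finite X" using A by (auto simp: nsets_def)
    with 0 have "X \<inter> Y - {1..N} = {}" by auto
    then have "X \<inter> Y \<inter> {1..N} = X \<inter> Y" by auto
    then show ?case using cr 0 Y by (auto simp: cross_intersecting_def)
  next
    case (Suc k)
    have X: "finite X" "card X = r" "X \<subseteq> {1..m}" using Suc.prems A by (auto simp: nsets_def)
    have Y': "finite Y" "card Y = s" "Y \<subseteq> {1..n}" using Y B by (auto simp: nsets_def)
    show ?case
    proof (rule ccontr)
      assume "\<not> ?thesis"
      then have lt: "card (X \<inter> Y \<inter> {1..N}) < t" by simp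
      have "X \<inter> Y - {1..N} \<noteq> {}" using Suc.hyps(2) by (metis card.empty Zero_not_Suc)
      then obtain z where z: "z \<in> X \<inter> Y - {1..N}" by blast
      have tXY: "t \<le> card (X \<inter> Y)" using cr Suc.prems Y by (auto simp: cross_intersecting_def)
      have c1: "card (X \<union> Y) + card (X \<inter> Y) = r + s"
        using card_Un_Int[OF X(1) Y'(1)] X Y' by simp
      have "z \<in> X" "1 \<le> z" "z \<notin> {1..N}" "z \<in> Y" using z X by auto
      then have zN: "N < z" by auto
      \<comment> \<open>the element \<open>z\<close> of \<open>X \<union> Y\<close> lies beyond the prefix\<close>
      have "\<exists>w. w \<in> {1..N} \<and> w \<notin> X \<union> Y"
      proof (rule ccontr)
        assume "\<not> ?thesis"
        then have "{1..N} \<subseteq> (X \<union> Y) - {z}" using zN by auto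
        then have "card {1..N} \<le> card ((X \<union> Y) - {z})" using X Y' by (intro card_mono) auto
        also have "\<dots> < card (X \<union> Y)" using z X Y' by (intro psubset_card_mono) auto
        finally show False using c1 tXY unfolding N_def by simp
      qed
      then obtain w where w: "w \<in> {1..N}" "w \<notin> X" "w \<notin> Y" by auto
      let ?X = "insert w (X - {z})"
      have XA: "?X \<in> \<A>" using sh Suc.prems \<open>z \<in> X\<close> w zN unfolding left_shifted_def by auto
      have e1: "?X \<inter> Y - {1..N} = (X \<inter> Y - {1..N}) - {z}" using w by auto
      have e2: "?X \<inter> Y \<inter> {1..N} = X \<inter> Y \<inter> {1..N}" using w zN by auto
      have "k = card (?X \<inter> Y - {1..N})" using e1 z Suc.hyps(2) by simp
      from Suc.hyps(1)[OF this XA] e2 lt show False by simp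
    qed
  qed
  then show ?thesis unfolding prefix_cross_def N_def by blast
qed

section \<open>Pivots and exchanges\<close>

text \<open>
  The size of the conflicting trace on the other side is not prescribed: where the definition is
  used, it is \<open>l + t - 2 - i\<close>, by \<open>pivotal_pair_union\<close> below.
\<close>
definition pivots :: "nat \<Rightarrow> nat \<Rightarrow> nat \<Rightarrow> nat set set \<Rightarrow> nat set set \<Rightarrow> nat set set"
  where "pivots t l i \<A> \<B> = {S \<in> [{1..<l}]\<^bsup>i\<^esup>.
    (\<exists>X\<in>\<A>. X \<inter> {1..l} = insert l S) \<and> (\<exists>Y\<in>\<B>. l \<in> Y \<and> card (S \<inter> Y) < t)}"

lemma pivotsD:
  assumes "S \<in> pivots t l i \<A> \<B>"
  shows "S \<subseteq> {1..<l}" "card S = i" "l \<notin> S"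
  using assms by (auto simp: pivots_def nsets_def)

lemma trace_with_last:
  fixes l :: nat
  assumes "S \<subseteq> {1..<l}" "X \<inter> {1..l} = insert l S"
  shows "l \<in> X" "X \<inter> {1..<l} = S"
proof -
  show "l \<in> X" using assms(2) by blast
  show "X \<inter> {1..<l} = S"
  proof -
    have "X \<inter> {1..<l} = (X \<inter> {1..l}) \<inter> {1..<l}" by (auto intro: less_imp_le)
    then show ?thesis using assms by auto
  qed
qed

lemma pivots_finite: "finite (pivots t l i \<A> \<B>)"
  by (rule finite_subset[of _ "[{1..<l}]\<^bsup>i\<^esup>"]) (auto simp: pivots_def finite_imp_finite_nsets)

text \<open>
  The last element \<open>l\<close> is deleted from the traces in \<open>\<P>\<^sub>1\<close>, and the members belonging to the other
  pivots are discarded. No pivot is itself a trace (\<open>pivot_not_trace\<close>), so the new sets are really new. The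
  members with trace \<open>insert l S\<close> for \<open>S \<in> \<P>\<^sub>1\<close> are kept.
\<close>
definition exchange :: "nat \<Rightarrow> nat \<Rightarrow> nat \<Rightarrow> nat set set \<Rightarrow> nat set set \<Rightarrow> nat set set \<Rightarrow> nat set set"
  where "exchange m r l \<P> \<P>\<^sub>1 \<A> =
    (\<A> - cylinder {1..m} r {1..l} (insert l ` (\<P> - \<P>\<^sub>1))) \<union> cylinder {1..m} r {1..l} \<P>\<^sub>1"

lemma exchange_subset: "\<A> \<subseteq> [{1..m}]\<^bsup>r\<^esup> \<Longrightarrow> exchange m r l \<P> \<P>\<^sub>1 \<A> \<subseteq> [{1..m}]\<^bsup>r\<^esup>"
  by (auto simp: exchange_def cylinder_def)

locale shifted_max_pair =
  fixes m r n s t l :: nat and \<A> \<B> :: "nat set set"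
  assumes max: "max_pair t m r n s \<A> \<B>"
    and shA: "left_shifted \<A>" and shB: "left_shifted \<B>"
    and neA: "\<A> \<noteq> {}" and neB: "\<B> \<noteq> {}"
    and pre: "prefix_cross t l \<A> \<B>"
    and t1: "1 \<le> t" and tl: "t < l" and lm: "l \<le> m" and ln: "l \<le> n"
begin

lemma swap: "shifted_max_pair n s m r t l \<B> \<A>"
  by unfold_locales
    (use max_pair_commute[OF max] shA shB neA neB prefix_cross_commute[OF pre] t1 tl lm ln in auto)

lemma subA: "\<A> \<subseteq> [{1..m}]\<^bsup>r\<^esup>" and subB: "\<B> \<subseteq> [{1..n}]\<^bsup>s\<^esup>"
  using max unfolding max_pair_def by auto

lemma memA: assumes "X \<in> \<A>" shows "finite X" "card X = r" "X \<subseteq> {1..m}"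
  using assms subA by (auto simp: nsets_def)

lemma finA: "finite \<A>" using max_pair_finite[OF max] by simp

lemma card_posA: "0 < card \<A>" using finA neA by (simp add: card_gt_0_iff)

lemma prefixD: "X \<in> \<A> \<Longrightarrow> Y \<in> \<B> \<Longrightarrow> t \<le> card (X \<inter> Y \<inter> {1..l})"
  using pre unfolding prefix_cross_def by blast

lemma shiftA: "X \<in> \<A> \<Longrightarrow> j \<in> X \<Longrightarrow> 1 \<le> i \<Longrightarrow> i < j \<Longrightarrow> i \<notin> X \<Longrightarrow> insert i (X - {j}) \<in> \<A>"
  using shA unfolding left_shifted_def by blast

lemma l_split: "{1..l} = insert l {1..<l}" using t1 tl by auto

text \<open>
  Enlarging the prefix part of a member creates no conflict, so by maximality the result is
  already a member.
\<close>
lemma prefix_determined: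
  assumes X: "X \<in> \<A>" and Z: "Z \<in> [{1..m}]\<^bsup>r\<^esup>" and sub: "X \<inter> {1..l} \<subseteq> Z"
  shows "Z \<in> \<A>"
proof (rule ccontr)
  assume ZA: "Z \<notin> \<A>"
  have "prefix_cross t l (insert Z \<A>) \<B>"
    unfolding prefix_cross_def
  proof (intro ballI)
    fix W Y assume W: "W \<in> insert Z \<A>" and Y: "Y \<in> \<B>"
    show "t \<le> card (W \<inter> Y \<inter> {1..l})"
    proof (cases "W = Z")
      case True
      have "card (X \<inter> Y \<inter> {1..l}) \<le> card (W \<inter> Y \<inter> {1..l})"
        using sub True by (intro card_mono) auto
      then show ?thesis using prefixD[OF X Y] by linarith
    qed (use W Y prefixD in auto)
  qed
  moreover have "insert Z \<A> \<subseteq> [{1..m}]\<^bsup>r\<^esup>" using Z subA by auto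
  ultimately have "card (insert Z \<A>) * card \<B> \<le> card \<A> * card \<B>"
    by (intro max_pair_maximal[OF max] subB prefix_cross_imp_cross)
  moreover have "0 < card \<B>" by (rule shifted_max_pair.card_posA[OF swap])
  ultimately show False using ZA finA by simp
qed

lemma cylinder_subset:
  assumes "\<And>S. S \<in> \<S> \<Longrightarrow> \<exists>X\<in>\<A>. X \<inter> {1..l} = S"
  shows "cylinder {1..m} r {1..l} \<S> \<subseteq> \<A>"
proof
  fix Z assume "Z \<in> cylinder {1..m} r {1..l} \<S>"
  then have Z: "Z \<in> [{1..m}]\<^bsup>r\<^esup>" "Z \<inter> {1..l} \<in> \<S>" by (auto simp: cylinder_def)
  from assms[OF Z(2)] obtain X where "X \<in> \<A>" "X \<inter> {1..l} = Z \<inter> {1..l}" by blast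
  then show "Z \<in> \<A>" using prefix_determined[OF _ Z(1)] by auto
qed

text \<open>
  Some \<open>z < l\<close> outside \<open>X \<union> Y\<close> would allow \<open>l\<close> to be shifted to \<open>z\<close> in \<open>X\<close>, after which \<open>X\<close> and \<open>Y\<close> share
  only \<open>t - 1\<close> elements of the prefix. Hence the two traces cover \<open>{1..<l}\<close> and meet in \<open>t - 1\<close>
  elements, and inclusion-exclusion gives the sum of their sizes.
\<close>
lemma pivotal_pair_union:
  assumes X: "X \<in> \<A>" "l \<in> X" and Y: "Y \<in> \<B>" "l \<in> Y" and lt: "card (X \<inter> Y \<inter> {1..<l}) < t"
  shows "card (X \<inter> {1..<l}) + card (Y \<inter> {1..<l}) + 2 = l + t"
proof -
  have "X \<inter> Y \<inter> {1..l} = insert l (X \<inter> Y \<inter> {1..<l})" using X Y l_split by auto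
  then have "card (X \<inter> Y \<inter> {1..l}) = Suc (card (X \<inter> Y \<inter> {1..<l}))" by simp
  then have c: "card (X \<inter> Y \<inter> {1..<l}) + 1 = t" using prefixD[OF X(1) Y(1)] lt by simp
  have "{1..<l} \<subseteq> X \<union> Y"
  proof
    fix z assume z: "z \<in> {1..<l}"
    show "z \<in> X \<union> Y"
    proof (rule ccontr)
      assume n: "z \<notin> X \<union> Y"
      have "insert z (X - {l}) \<in> \<A>" using shiftA[OF X] z n by auto
      from prefixD[OF this Y(1)] have "t \<le> card (insert z (X - {l}) \<inter> Y \<inter> {1..l})" .
      moreover have "insert z (X - {l}) \<inter> Y \<inter> {1..l} = X \<inter> Y \<inter> {1..<l}" using n by auto
      ultimately show False using lt by simp
    qed
  qed
  then have u: "X \<inter> {1..<l} \<union> Y \<inter> {1..<l} = {1..<l}" by auto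
  have "X \<inter> {1..<l} \<inter> (Y \<inter> {1..<l}) = X \<inter> Y \<inter> {1..<l}" by auto
  with card_Un_Int[of "X \<inter> {1..<l}" "Y \<inter> {1..<l}"] u c show ?thesis using tl by simp
qed

lemma pivot_conflict:
  assumes ij: "i + j + 2 = l + t" and S: "S \<in> pivots t l i \<A> \<B>"
    and Y: "Y \<in> \<B>" "l \<in> Y" and lt: "card (S \<inter> Y) < t"
  shows "Y \<inter> {1..<l} \<in> pivots t l j \<B> \<A>"
proof -
  from S obtain X where S': "S \<subseteq> {1..<l}" "card S = i" and X: "X \<in> \<A>" "X \<inter> {1..l} = insert l S"
    by (auto simp: pivots_def nsets_def)
  note X' = trace_with_last[OF S'(1) X(2)]
  have e: "X \<inter> Y \<inter> {1..<l} = S \<inter> Y" "Y \<inter> {1..<l} \<inter> X = S \<inter> Y" using X'(2) by auto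
  have "card (Y \<inter> {1..<l}) = j"
    using pivotal_pair_union[OF X(1) X'(1) Y] lt e X'(2) S' ij by simp
  moreover have "Y \<inter> {1..l} = insert l (Y \<inter> {1..<l})" using Y(2) l_split by auto
  ultimately show ?thesis
    using Y X(1) X'(1) lt unfolding pivots_def nsets_def mem_Collect_eq e(2)[symmetric]
    by (metis Int_lower2 finite_Int finite_atLeastLessThan)
qed

text \<open>
  A set whose trace is a pivot \<open>S\<close> can conflict only with members of the other family whose trace
  is \<open>insert l R\<close> for a pivot \<open>R\<close> with \<open>|S \<inter> R| < t\<close>, and the exchange discards these unless
  \<open>R \<in> \<Q>\<^sub>1\<close>.
\<close>
lemma new_old_cross:
  assumes ij: "i + j + 2 = l + t" and S: "X \<inter> {1..l} = S" "S \<in> pivots t l i \<A> \<B>"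
    and Y: "Y \<in> \<B>" "Y \<notin> cylinder {1..n} s {1..l} (insert l ` (pivots t l j \<B> \<A> - \<Q>\<^sub>1))"
    and compat: "\<And>R. R \<in> \<Q>\<^sub>1 \<Longrightarrow> t \<le> card (S \<inter> R)"
  shows "t \<le> card (X \<inter> Y \<inter> {1..l})"
proof (rule ccontr)
  assume "\<not> ?thesis"
  moreover have "X \<inter> Y \<inter> {1..l} = S \<inter> Y" using S by auto
  ultimately have lt: "card (S \<inter> Y) < t" by simp
  from S obtain X' where S': "S \<subseteq> {1..<l}" and X': "X' \<in> \<A>" "X' \<inter> {1..l} = insert l S"
    by (auto simp: pivots_def nsets_def)
  have lY: "l \<in> Y"
  proof (rule ccontr)
    assume "l \<notin> Y"
    have "X' \<inter> Y \<inter> {1..l} = (X' \<inter> {1..l}) \<inter> Y" by auto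
    also have "\<dots> = S \<inter> Y" using \<open>l \<notin> Y\<close> X'(2) by auto
    finally have "X' \<inter> Y \<inter> {1..l} = S \<inter> Y" .
    then show False using prefixD[OF X'(1) Y(1)] lt by simp
  qed
  let ?R = "Y \<inter> {1..<l}"
  have R: "?R \<in> pivots t l j \<B> \<A>" by (rule pivot_conflict[OF ij S(2) Y(1) lY lt])
  have "Y \<inter> {1..l} = insert l ?R" using lY l_split by auto
  then have "?R \<in> \<Q>\<^sub>1" using Y R subB by (auto simp: cylinder_def)
  from compat[OF this] have "t \<le> card (S \<inter> ?R)" .
  moreover have "S \<inter> ?R = S \<inter> Y" using S' by auto
  ultimately show False using lt by simp
qed

lemma pivot_not_trace:
  assumes S: "S \<in> pivots t l i \<A> \<B>" shows "cylinder {1..m} r {1..l} {S} \<inter> \<A> = {}"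
proof -
  from S obtain Y where Y: "Y \<in> \<B>" "card (S \<inter> Y) < t" by (auto simp: pivots_def)
  { fix X assume X: "X \<in> \<A>" "X \<inter> {1..l} = S"
    then have "X \<inter> Y \<inter> {1..l} = S \<inter> Y" by auto
    with prefixD[OF X(1) Y(1)] Y(2) have False by simp }
  then show ?thesis by (auto simp: cylinder_def)
qed

lemma exchange_prefix_cross:
  assumes ij: "i + j + 2 = l + t"
    and P1: "\<P>\<^sub>1 \<subseteq> pivots t l i \<A> \<B>" and Q1: "\<Q>\<^sub>1 \<subseteq> pivots t l j \<B> \<A>"
    and compat: "\<And>S R. S \<in> \<P>\<^sub>1 \<Longrightarrow> R \<in> \<Q>\<^sub>1 \<Longrightarrow> t \<le> card (S \<inter> R)"
  shows "prefix_cross t l (exchange m r l (pivots t l i \<A> \<B>) \<P>\<^sub>1 \<A>)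
                          (exchange n s l (pivots t l j \<B> \<A>) \<Q>\<^sub>1 \<B>)"
  unfolding prefix_cross_def
proof (intro ballI)
  interpret sw: shifted_max_pair n s m r t l \<B> \<A> by (rule swap)
  fix X Y
  assume X: "X \<in> exchange m r l (pivots t l i \<A> \<B>) \<P>\<^sub>1 \<A>"
    and Y: "Y \<in> exchange n s l (pivots t l j \<B> \<A>) \<Q>\<^sub>1 \<B>"
  consider (oo) "X \<in> \<A>" "Y \<in> \<B>"
    | (no) "X \<inter> {1..l} \<in> \<P>\<^sub>1" "Y \<in> \<B>"
        "Y \<notin> cylinder {1..n} s {1..l} (insert l ` (pivots t l j \<B> \<A> - \<Q>\<^sub>1))"
    | (on) "Y \<inter> {1..l} \<in> \<Q>\<^sub>1" "X \<in> \<A>"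
        "X \<notin> cylinder {1..m} r {1..l} (insert l ` (pivots t l i \<A> \<B> - \<P>\<^sub>1))"
    | (nn) "X \<inter> {1..l} \<in> \<P>\<^sub>1" "Y \<inter> {1..l} \<in> \<Q>\<^sub>1"
    using X Y unfolding exchange_def by (auto simp: cylinder_def)
  then show "t \<le> card (X \<inter> Y \<inter> {1..l})"
  proof cases
    case oo then show ?thesis by (rule prefixD)
  next
    case no then show ?thesis
      using new_old_cross[OF ij refl _ no(2,3)] P1 compat by blast
  next
    case on
    have "j + i + 2 = l + t" using ij by simp
    from sw.new_old_cross[OF this refl _ on(2,3)] have "t \<le> card (Y \<inter> X \<inter> {1..l})"
      using on(1) Q1 compat by (metis Int_commute subsetD)
    then show ?thesis by (simp add: Int_commute)
  next
    case nn
    have "X \<inter> Y \<inter> {1..l} = (X \<inter> {1..l}) \<inter> (Y \<inter> {1..l})" by auto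
    then show ?thesis using compat[OF nn] by simp
  qed
qed

lemma card_exchange:
  assumes P1: "\<P>\<^sub>1 \<subseteq> pivots t l i \<A> \<B>" and i: "i < r"
  shows "card (exchange m r l (pivots t l i \<A> \<B>) \<P>\<^sub>1 \<A>)
           + card (pivots t l i \<A> \<B> - \<P>\<^sub>1) * ((m - l) choose (r - Suc i))
         = card \<A> + card \<P>\<^sub>1 * ((m - l) choose (r - i))"
proof -
  let ?P = "pivots t l i \<A> \<B>" let ?C = "cylinder {1..m} r {1..l}"
  have sub: "?P \<subseteq> [{1..<l}]\<^bsup>i\<^esup>" by (auto simp: pivots_def)
  have nl: "l \<notin> S" if "S \<in> ?P" for S using pivotsD(3)[OF that] .
  have inj: "inj_on (insert l) (?P - \<P>\<^sub>1)" using nl by (intro inj_onI) (metis Diff_iff insert_ident)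
  have s1: "insert l ` (?P - \<P>\<^sub>1) \<subseteq> [{1..l}]\<^bsup>Suc i\<^esup>"
    using sub nl t1 tl by (auto simp: nsets_def subset_eq intro: less_imp_le)
  have s2: "\<P>\<^sub>1 \<subseteq> [{1..l}]\<^bsup>i\<^esup>" using P1 sub by (auto simp: nsets_def subset_eq intro: less_imp_le)
  have L: "{1..l} \<subseteq> {1..m}" using lm by auto
  have c1: "card (?C (insert l ` (?P - \<P>\<^sub>1))) = card (?P - \<P>\<^sub>1) * ((m - l) choose (r - Suc i))"
    using card_cylinder[OF _ L s1] i card_image[OF inj] by simp
  have c2: "card (?C \<P>\<^sub>1) = card \<P>\<^sub>1 * ((m - l) choose (r - i))"
    using card_cylinder[OF _ L s2] i by simp
  have in_A: "?C (insert l ` (?P - \<P>\<^sub>1)) \<subseteq> \<A>"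
    by (rule cylinder_subset) (auto simp: pivots_def)
  have disj: "?C \<P>\<^sub>1 \<inter> \<A> = {}"
    using pivot_not_trace P1 unfolding cylinder_def by blast
  have "card (exchange m r l ?P \<P>\<^sub>1 \<A>) = card (\<A> - ?C (insert l ` (?P - \<P>\<^sub>1))) + card (?C \<P>\<^sub>1)"
    unfolding exchange_def using disj finA finite_cylinder[of "{1..m}"] by (intro card_Un_disjoint) auto
  moreover have "card (\<A> - ?C (insert l ` (?P - \<P>\<^sub>1))) + card (?C (insert l ` (?P - \<P>\<^sub>1))) = card \<A>"
    using in_A finA finite_subset[OF in_A finA] by (simp add: card_Diff_subset card_mono)
  ultimately show ?thesis using c1 c2 by simp
qed

text \<open>
  Let \<open>D\<close> consist of the sets \<open>insert z S\<close> with \<open>S\<close> a pivot and \<open>z < l\<close>. Shifting \<open>l\<close> to \<open>z\<close> shows that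
  they are traces of \<open>\<A>\<close>. They have as many elements as the pivotal traces \<open>insert l S\<close> but avoid \<open>l\<close>, so
  the two kinds of traces contribute disjoint classes of equal size. Counting incidences bounds
  \<open>|D|\<close> from below.
\<close>
lemma pivots_shadow:
  assumes i: "i < r"
  obtains D where "D \<subseteq> [{1..<l}]\<^bsup>Suc i\<^esup>"
    "card (pivots t l i \<A> \<B>) * (l - 1 - i) \<le> card D * Suc i"
    "(card (pivots t l i \<A> \<B>) + card D) * ((m - l) choose (r - Suc i)) \<le> card \<A>"
proof -
  let ?P = "pivots t l i \<A> \<B>" let ?C = "cylinder {1..m} r {1..l}"
  define D where "D = {S'. \<exists>S\<in>?P. \<exists>z\<in>{1..<l} - S. S' = insert z S}"
  have sub: "?P \<subseteq> [{1..<l}]\<^bsup>i\<^esup>" by (auto simp: pivots_def)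
  have nl: "l \<notin> S" if "S \<in> ?P" for S using pivotsD(3)[OF that] .
  have D: "D \<subseteq> [{1..<l}]\<^bsup>Suc i\<^esup>" using sub unfolding D_def by (auto simp: nsets_def subset_eq)
  have finD: "finite D" by (rule finite_subset[OF D]) (simp add: finite_imp_finite_nsets)
  have "card ?P * (l - 1 - i) \<le> card D * Suc i"
  proof -
    have "card (SIGMA S:?P. {1..<l} - S) = (\<Sum>S\<in>?P. card ({1..<l} - S))"
      using pivots_finite by (intro card_SigmaI) auto
    also have "\<dots> = (\<Sum>S\<in>?P. l - 1 - i)"
      using sub by (intro sum.cong refl) (auto simp: nsets_def card_Diff_subset subset_eq)
    finally have e1: "card (SIGMA S:?P. {1..<l} - S) = card ?P * (l - 1 - i)" by simp
    have finE: "finite S'" "card S' = Suc i" if "S' \<in> D" for S' using that D by (auto simp: nsets_def)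
    have "card (SIGMA S':D. S') = (\<Sum>S'\<in>D. card S')"
      using finD finE by (intro card_SigmaI) auto
    also have "\<dots> = card D * Suc i" using finE by simp
    finally have e2: "card (SIGMA S':D. S') = card D * Suc i" .
    have "inj_on (\<lambda>(S, z). (insert z S, z)) (SIGMA S:?P. {1..<l} - S)"
      by (intro inj_onI) (auto; metis insert_ident)
    moreover have "(\<lambda>(S, z). (insert z S, z)) ` (SIGMA S:?P. {1..<l} - S) \<subseteq> (SIGMA S':D. S')"
      unfolding D_def by auto
    moreover have "finite (SIGMA S':D. S')" using finD finE by auto
    ultimately have "card (SIGMA S:?P. {1..<l} - S) \<le> card (SIGMA S':D. S')" by (rule card_inj_on_le)
    then show ?thesis using e1 e2 by simp
  qed
  moreover have "(card ?P + card D) * ((m - l) choose (r - Suc i)) \<le> card \<A>"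
  proof -
    have inj: "inj_on (insert l) ?P" using nl by (intro inj_onI) (metis insert_ident)
    have s: "insert l ` ?P \<union> D \<subseteq> [{1..l}]\<^bsup>Suc i\<^esup>"
      using sub nl D t1 tl by (auto simp: nsets_def subset_eq intro: less_imp_le)
    have L: "{1..l} \<subseteq> {1..m}" using lm by auto
    have "insert l ` ?P \<inter> D = {}" using D by (auto simp: nsets_def)
    then have "card (insert l ` ?P \<union> D) = card ?P + card D"
      using card_Un_disjoint[of "insert l ` ?P" D] finD pivots_finite card_image[OF inj] by simp
    then have "card (?C (insert l ` ?P \<union> D)) = (card ?P + card D) * ((m - l) choose (r - Suc i))"
      using card_cylinder[OF _ L s] i by simp
    moreover have "?C (insert l ` ?P \<union> D) \<subseteq> \<A>"
    proof (rule cylinder_subset)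
      fix S' assume "S' \<in> insert l ` ?P \<union> D"
      then show "\<exists>X\<in>\<A>. X \<inter> {1..l} = S'"
      proof
        assume "S' \<in> insert l ` ?P" then show ?thesis by (auto simp: pivots_def)
      next
        assume "S' \<in> D"
        then obtain S z where S: "S \<in> ?P" "z \<in> {1..<l}" "z \<notin> S" "S' = insert z S"
          unfolding D_def by auto
        then obtain X where S': "S \<subseteq> {1..<l}" and X: "X \<in> \<A>" "X \<inter> {1..l} = insert l S"
          by (auto simp: pivots_def nsets_def)
        note X' = trace_with_last[OF S' X(2)]
        have "z \<notin> X" using S X'(2) by auto
        then have "insert z (X - {l}) \<in> \<A>" using shiftA[OF X(1) X'(1)] S by auto
        moreover have "insert z (X - {l}) \<inter> {1..l} = S'" using X'(2) S l_split by auto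
        ultimately show ?thesis by blast
      qed
    qed
    ultimately show ?thesis using card_mono[OF finA] by metis
  qed
  ultimately show ?thesis using that D by blast
qed

end

section \<open>Descent of the prefix\<close>

lemma binomial_ratio:
  fixes L :: real
  assumes k: "k \<ge> 1" and le: "(L + 1) * real k \<le> real M + 1"
  shows "L * real (M choose (k - 1)) \<le> real (M choose k)"
proof (cases "M choose (k - 1) = 0")
  case False
  then have kM: "k - 1 \<le> M" by (meson binomial_eq_0 not_le)
  have "k * (M choose k) = (M - (k - 1)) * (M choose (k - 1))"
    using binomial_absorption[of "k - 1" M] binomial_absorb_comp[of M "k - 1"] k by simp
  then have "real k * real (M choose k) = real (M - (k - 1)) * real (M choose (k - 1))"
    by (metis of_nat_mult)
  moreover have "real (M - (k - 1)) = real M - real k + 1" using kM k by (simp add: of_nat_diff)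
  ultimately have e: "real k * real (M choose k) = (real M - real k + 1) * real (M choose (k - 1))"
    by simp
  have "L * real k \<le> real M - real k + 1" using le by (simp add: algebra_simps)
  then have "(L * real k) * real (M choose (k - 1)) \<le> real k * real (M choose k)"
    unfolding e by (intro mult_right_mono) auto
  then have "real k * (L * real (M choose (k - 1))) \<le> real k * real (M choose k)"
    by (simp add: algebra_simps)
  then show ?thesis using k by (simp add: mult_le_cancel_left)
qed (simp add: binomial_eq_0)

text \<open>
  With \<open>\<alpha> = x / a\<close> and \<open>\<beta> = y / b\<close> the two inequalities read \<open>L\<alpha>(1 - \<beta>) \<le> \<beta>\<close> and \<open>L\<beta>(1 - \<alpha>) \<le> \<alpha>\<close>.
  Whichever of \<open>\<alpha>\<close>, \<open>\<beta>\<close> is smaller is at least \<open>1 - 1 / L\<close>, hence so are both.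
\<close>
lemma exchange_balance:
  fixes a b x y L :: real
  assumes "0 < a" "0 < b" "0 < x" "0 < y" "x \<le> a" "y \<le> b" "0 \<le> L"
    and e1: "(a + L * x) * (b - y) \<le> a * b" and e2: "(a - x) * (b + L * y) \<le> a * b"
  shows "L * (a - x) \<le> a"
proof (cases "y * a \<le> x * b")
  case True
  have "L * (b - y) * x \<le> y * a" using e1 by (simp add: algebra_simps)
  then have "L * (b - y) * x \<le> b * x" using True by (simp add: mult.commute)
  then have "L * (b - y) \<le> b" using \<open>0 < x\<close> by simp
  have "b * (a - x) \<le> a * (b - y)" using True by (simp add: algebra_simps)
  then have "L * (b * (a - x)) \<le> L * (a * (b - y))" using \<open>0 \<le> L\<close> by (rule mult_left_mono)
  also have "\<dots> = a * (L * (b - y))" by simp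
  also have "\<dots> \<le> a * b" using \<open>L * (b - y) \<le> b\<close> \<open>0 < a\<close> by (intro mult_left_mono) auto
  finally have "b * (L * (a - x)) \<le> b * a" by (simp add: algebra_simps)
  then show ?thesis using \<open>0 < b\<close> by simp
next
  case False
  have "L * (a - x) * y \<le> x * b" using e2 by (simp add: algebra_simps)
  then have "L * (a - x) * y \<le> a * y" using False by (simp add: mult.commute)
  then show ?thesis using \<open>0 < y\<close> by simp
qed

text \<open>
  Here \<open>L\<close> stands for \<open>t + u\<close>. The conditions are symmetric in the two families, so that every lemma
  can be used with their roles exchanged; \<open>not_tight\<close> covers both the strict case and a would-be
  counterexample to the bound in the case \<open>L = t\<close>.
\<close>
locale reducible_max_pair = shifted_max_pair +
  fixes L :: real
  assumes L_ge: "real t \<le> L" and L_gt: "6 + 2 * real t < 3 * L"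
    and m_ge: "real l + (L + 1) * (real r - real t) \<le> real m + 1"
    and n_ge: "real l + (L + 1) * (real s - real t) \<le> real n + 1"
    and not_tight: "real t < L \<or>
      ((m - t) choose (r - t)) * ((n - t) choose (s - t)) < card \<A> * card \<B>"
begin

lemma reducible_swap: "reducible_max_pair n s m r t l \<B> \<A> L"
  by (intro reducible_max_pair.intro swap reducible_max_pair_axioms.intro)
    (use L_ge L_gt m_ge n_ge not_tight in \<open>auto simp: mult.commute\<close>)

lemma class_ratio:
  assumes "t \<le> i" "i < r"
  shows "L * real ((m - l) choose (r - Suc i)) \<le> real ((m - l) choose (r - i))"
proof -
  have "(L + 1) * real (r - i) \<le> (L + 1) * (real r - real t)"
    using assms L_ge by (intro mult_left_mono) auto
  also have "\<dots> \<le> real (m - l) + 1" using m_ge lm by (simp add: of_nat_diff)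
  finally have "L * real ((m - l) choose (r - i - 1)) \<le> real ((m - l) choose (r - i))"
    using assms by (intro binomial_ratio) auto
  then show ?thesis by simp
qed

lemma members_contain:
  assumes pc: "prefix_cross t l \<A>' \<B>'" and mem: "X \<in> \<A>'" and X: "X \<inter> {1..l} = S"
    and S: "card S = t" and Y: "Y \<in> \<B>'"
  shows "S \<subseteq> Y"
proof -
  have "X \<inter> Y \<inter> {1..l} = S \<inter> Y" using X by auto
  then have "card S \<le> card (S \<inter> Y)" using pc mem Y S unfolding prefix_cross_def by force
  moreover have "finite S" using X by auto
  ultimately have "S \<inter> Y = S" by (intro card_seteq) auto
  then show ?thesis by auto
qed

text \<open>
  This ends both cases of the descent: with \<open>L > t\<close> the new pair contradicts maximality, and with
  \<open>L = t\<close> it shows that the maximum product obeys the bound.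
\<close>
lemma in_stars_impossible:
  assumes A': "\<A>' \<subseteq> [{1..m}]\<^bsup>r\<^esup>" and B': "\<B>' \<subseteq> [{1..n}]\<^bsup>s\<^esup>"
    and S: "S \<subseteq> {1..l}" "card S = t" "t \<le> r" "t \<le> s"
    and star: "\<And>X. X \<in> \<A>' \<Longrightarrow> S \<subseteq> X" "\<And>Y. Y \<in> \<B>' \<Longrightarrow> S \<subseteq> Y"
    and ge: "card \<A> * card \<B> \<le> card \<A>' * card \<B>'"
    and strict: "real t < L \<Longrightarrow> card \<A> * card \<B> < card \<A>' * card \<B>'"
    and cr: "cross_intersecting t \<A>' \<B>'"
  shows False
proof -
  have "\<A>' \<subseteq> {X \<in> [{1..m}]\<^bsup>r\<^esup>. S \<subseteq> X}" "\<B>' \<subseteq> {X \<in> [{1..n}]\<^bsup>s\<^esup>. S \<subseteq> X}"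
    using A' B' star by blast+
  then have "card \<A>' \<le> card {X \<in> [{1..m}]\<^bsup>r\<^esup>. S \<subseteq> X}" "card \<B>' \<le> card {X \<in> [{1..n}]\<^bsup>s\<^esup>. S \<subseteq> X}"
    using finite_imp_finite_nsets[of "{1..m}" r] finite_imp_finite_nsets[of "{1..n}" s]
    by (auto intro!: card_mono)
  moreover have "S \<subseteq> {1..m}" "S \<subseteq> {1..n}" using S(1) lm ln by auto
  ultimately have "card \<A>' * card \<B>' \<le> ((m - t) choose (r - t)) * ((n - t) choose (s - t))"
    using card_star[of "{1..m}" S r] card_star[of "{1..n}" S s] S by (simp add: mult_le_mono)
  then show False using not_tight ge strict max_pair_maximal[OF max A' B' cr] by linarith
qed

text \<open>
  Deleting \<open>l\<close> from all pivots of \<open>\<A>\<close> costs \<open>\<B>\<close> all members with pivotal traces.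
\<close>
lemma exchange_left:
  assumes ij: "i + j + 2 = l + t" and i: "i < r" and j: "j < s"
  defines "p \<equiv> card (pivots t l i \<A> \<B>)" and "q \<equiv> card (pivots t l j \<B> \<A>)"
  shows "(real (card \<A>) + real p * real ((m - l) choose (r - i))) *
         (real (card \<B>) - real q * real ((n - l) choose (s - Suc j))) \<le> real (card \<A>) * real (card \<B>)"
proof -
  interpret sw: shifted_max_pair n s m r t l \<B> \<A> by (rule swap)
  let ?A = "exchange m r l (pivots t l i \<A> \<B>) (pivots t l i \<A> \<B>) \<A>"
  let ?B = "exchange n s l (pivots t l j \<B> \<A>) {} \<B>"
  have pc: "prefix_cross t l ?A ?B" by (intro exchange_prefix_cross[OF ij]) auto
  have le: "card ?A * card ?B \<le> card \<A> * card \<B>"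
    by (intro max_pair_maximal[OF max] exchange_subset subA subB
        prefix_cross_imp_cross[OF pc exchange_subset[OF subA]])
  have "card ?A = card \<A> + p * ((m - l) choose (r - i))"
    using card_exchange[OF _ i, of "pivots t l i \<A> \<B>"] by (simp add: p_def)
  moreover have "card ?B + q * ((n - l) choose (s - Suc j)) = card \<B>"
    using sw.card_exchange[OF _ j, of "{}"] by (simp add: q_def)
  then have "real (card ?B) = real (card \<B>) - real q * real ((n - l) choose (s - Suc j))"
    unfolding of_nat_mult[symmetric] by linarith
  moreover have "real (card ?A) * real (card ?B) \<le> real (card \<A>) * real (card \<B>)"
    using le unfolding of_nat_mult[symmetric] of_nat_le_iff .
  ultimately show ?thesis by (simp only: of_nat_add of_nat_mult)
qed

lemma class_weight_pos:
  assumes "X \<in> \<A>" "l \<in> X" "card (X \<inter> {1..<l}) = i"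
  shows "i < r" "0 < (m - l) choose (r - Suc i)"
proof -
  have e: "X \<inter> {1..l} = insert l (X \<inter> {1..<l})" using assms(2) l_split by auto
  then have c: "card (X \<inter> {1..l}) = Suc i" using assms(3) by simp
  have "card (X \<inter> {1..l}) \<le> card X" using memA[OF assms(1)] by (intro card_mono) auto
  then show "i < r" using c memA[OF assms(1)] by simp
  have "card (X - {1..l}) \<le> card ({1..m} - {1..l})" using memA[OF assms(1)] by (intro card_mono) auto
  moreover have "card (X - {1..l}) = r - Suc i"
    using card_Diff_subset_Int[of X "{1..l}"] c memA[OF assms(1)] by simp
  moreover have "card ({1..m} - {1..l}) = m - l" using lm by (simp add: card_Diff_subset)
  ultimately show "0 < (m - l) choose (r - Suc i)" by (simp add: zero_less_binomial)
qed

lemma pivot_fraction: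
  assumes "i < r" "i < l"
  shows "real (card (pivots t l i \<A> \<B>)) * real ((m - l) choose (r - Suc i)) * real l
     \<le> real (card \<A>) * real (Suc i)"
proof -
  let ?G = "(m - l) choose (r - Suc i)" let ?p = "card (pivots t l i \<A> \<B>)"
  obtain D where "D \<subseteq> [{1..<l}]\<^bsup>Suc i\<^esup>"
    and D: "?p * (l - 1 - i) \<le> card D * Suc i" "(?p + card D) * ?G \<le> card \<A>"
    by (rule pivots_shadow[OF assms(1)])
  have "(l - 1 - i) + Suc i = l" using assms(2) by simp
  then have "?p * l = ?p * ((l - 1 - i) + Suc i)" by (rule arg_cong[OF sym])
  also have "\<dots> = ?p * (l - 1 - i) + ?p * Suc i" by (rule add_mult_distrib2)
  also have "\<dots> \<le> card D * Suc i + ?p * Suc i" using D(1) by (rule add_right_mono)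
  also have "\<dots> = (?p + card D) * Suc i" unfolding add_mult_distrib by (rule add.commute)
  finally have "?p * l * ?G \<le> (?p + card D) * Suc i * ?G" by (rule mult_right_mono) simp
  also have "\<dots> = (?p + card D) * ?G * Suc i" by (simp only: ac_simps)
  also have "\<dots> \<le> card \<A> * Suc i" using D(2) by (rule mult_right_mono) simp
  finally have "?p * ?G * l \<le> card \<A> * Suc i" by (simp only: ac_simps)
  then show ?thesis unfolding of_nat_mult[symmetric] of_nat_le_iff .
qed

text \<open>
  The exchanged families have to contain at least one set with the new trace \<open>S\<close>, since
  \<open>members_contain\<close> is applied to such a set.
\<close>
lemma class_member:
  assumes "t \<le> i" "i < r" "0 < (m - l) choose (r - Suc i)" "S \<subseteq> {1..<l}" "card S = i"
  obtains X where "X \<in> cylinder {1..m} r {1..l} {S}"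
proof -
  have "0 < L * real ((m - l) choose (r - Suc i))"
    using assms(3) L_ge t1 by (intro mult_pos_pos) simp_all
  also have "\<dots> \<le> real ((m - l) choose (r - i))" using assms(1,2) by (rule class_ratio)
  finally have pos: "0 < (m - l) choose (r - i)" by (simp only: of_nat_0_less_iff)
  have "{S} \<subseteq> [{1..l}]\<^bsup>i\<^esup>"
    using assms(4,5) finite_subset[OF assms(4)] unfolding nsets_def by fastforce
  from card_cylinder[OF _ _ this, of "{1..m}" r] assms(2) lm pos
  have "0 < card (cylinder {1..m} r {1..l} {S})" by simp
  then have "cylinder {1..m} r {1..l} {S} \<noteq> {}" by (metis card.empty less_irrefl)
  then show ?thesis using that by blast
qed

text \<open>
  A trace of \<open>\<B>\<close> with exactly \<open>t\<close> elements lies in every member of \<open>\<A>\<close>, and so do all its shifts; hence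
  \<open>\<A>\<close> consists of the sets containing \<open>{1..l}\<close>. Replacing it by the sets containing \<open>{1..<l}\<close>
  multiplies its size by at least \<open>L + 1\<close>, while \<open>\<B>\<close> keeps at least the fraction \<open>(l - t) / l\<close>.
  The product of the two factors exceeds \<open>1\<close> unless \<open>L = t\<close> and \<open>l = t + 1\<close>, and then the new pair
  has centre \<open>{1..t}\<close>.
\<close>
lemma degenerate_pivot_impossible:
  assumes X: "X \<in> \<A>" "l \<in> X" and Y: "Y \<in> \<B>" "l \<in> Y"
    and lt: "card (X \<inter> Y \<inter> {1..<l}) < t" and j: "card (Y \<inter> {1..<l}) + 1 = t"
  shows False
proof -
  interpret sw: reducible_max_pair n s m r t l \<B> \<A> L by (rule reducible_swap)
  define j where "j = card (Y \<inter> {1..<l})"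
  define i where "i = l - 1"
  have ij: "i + j + 2 = l + t" and tj: "t = Suc j" using j tl unfolding i_def j_def by auto
  have Xl: "{1..l} \<subseteq> X'" if X': "X' \<in> \<A>" for X'
  proof
    have ins: "Y \<inter> {1..l} = insert l (Y \<inter> {1..<l})" using Y(2) l_split by auto
    have YX: "Z \<inter> {1..l} \<subseteq> X'" if "Z \<in> \<B>" "card (Z \<inter> {1..l}) = t" for Z
      using members_contain[OF prefix_cross_commute[OF pre] that(1) refl that(2) X'] .
    fix z assume z: "z \<in> {1..l}"
    show "z \<in> X'"
    proof (cases "z \<in> Y")
      case True
      moreover have "card (Y \<inter> {1..l}) = t" using ins j by simp
      ultimately show ?thesis using YX[OF Y(1)] z by blast
    next
      case False
      then have "z \<noteq> l" using Y(2) by auto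
      then have zl: "z < l" "1 \<le> z" using z by auto
      let ?Z = "insert z (Y - {l})"
      have "?Z \<in> \<B>" using sw.shiftA[OF Y] zl False by auto
      moreover have eZ: "?Z \<inter> {1..l} = insert z (Y \<inter> {1..<l})" using zl l_split by auto
      moreover have "card (?Z \<inter> {1..l}) = t" using eZ False j by simp
      ultimately show ?thesis using YX by blast
    qed
  qed
  have XI: "X \<inter> {1..<l} = {1..<l}" using Xl[OF X(1)] by auto
  have ci: "card (X \<inter> {1..<l}) = i" using XI by (simp add: i_def)
  let ?P = "pivots t l i \<A> \<B>" let ?Q = "pivots t l j \<B> \<A>"
  have e: "X \<inter> {1..l} = insert l {1..<l}" using Xl[OF X(1)] l_split by auto
  have "{1..<l} \<inter> Y = X \<inter> Y \<inter> {1..<l}" using XI by auto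
  then have "card ({1..<l} \<inter> Y) < t" using lt by simp
  then have "\<exists>Y\<in>\<B>. l \<in> Y \<and> card ({1..<l} \<inter> Y) < t" using Y by blast
  moreover have "\<exists>X\<in>\<A>. X \<inter> {1..l} = insert l {1..<l}" using X(1) e by blast
  ultimately have "{1..<l} \<in> ?P" unfolding pivots_def nsets_def i_def by simp
  moreover have "S = {1..<l}" if "S \<in> ?P" for S
    by (rule card_subset_eq) (use pivotsD[OF that] in \<open>simp_all add: i_def\<close>)
  ultimately have P: "?P = {{1..<l}}" by blast
  note w = class_weight_pos[OF X ci] and w' = sw.class_weight_pos[OF Y j_def[symmetric]]
  define a b G G' y where "a = real (card \<A>)" and "b = real (card \<B>)"
    and "G = real ((m - l) choose (r - i))" and "G' = real ((m - l) choose (r - Suc i))"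
    and "y = real (card ?Q) * real ((n - l) choose (s - Suc j))"
  have ab: "0 < a" "0 < b" using card_posA sw.card_posA by (auto simp: a_def b_def)
  have "\<A> = cylinder {1..m} r {1..l} {{1..l}}"
  proof
    show "\<A> \<subseteq> cylinder {1..m} r {1..l} {{1..l}}"
    proof
      fix X' assume "X' \<in> \<A>"
      then have "X' \<inter> {1..l} = {1..l}" "X' \<in> [{1..m}]\<^bsup>r\<^esup>" using Xl subA by blast+
      then show "X' \<in> cylinder {1..m} r {1..l} {{1..l}}" unfolding cylinder_def by simp
    qed
    have "X \<inter> {1..l} = {1..l}" using Xl[OF X(1)] by blast
    then show "cylinder {1..m} r {1..l} {{1..l}} \<subseteq> \<A>"
      using X(1) by (intro cylinder_subset) blast
  qed
  moreover have "card (cylinder {1..m} r {1..l} {{1..l}}) = 1 * ((m - l) choose (r - l))"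
  proof -
    have "card {{1..l}} * ((card {1..m} - card {1..l}) choose (r - l)) = 1 * ((m - l) choose (r - l))"
      by simp
    moreover have "l \<le> r" using w(1) tl by (simp add: i_def)
    moreover have "{{1..l}} \<subseteq> [{1..l}]\<^bsup>l\<^esup>" by (auto simp: nsets_def)
    ultimately show ?thesis using card_cylinder[of "{1..m}" "{1..l}" "{{1..l}}" l r] lm by simp
  qed
  ultimately have "card \<A> = (m - l) choose (r - l)" by (metis mult_1)
  then have aG: "a = G'" using tl unfolding a_def G'_def i_def by simp
  have ti: "t \<le> i" using tl by (simp add: i_def)
  have ratio: "L * G' \<le> G" unfolding G_def G'_def by (rule class_ratio[OF ti w(1)])
  have ex: "(a + G) * (b - y) \<le> a * b"
    using exchange_left[OF ij w(1) w'(1)] P by (simp add: a_def b_def G_def y_def)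
  have frac: "y * real l \<le> b * real t"
    using sw.pivot_fraction[OF w'(1)] tj tl by (simp add: y_def b_def)
  have yb: "b * (real l - real t) \<le> real l * (b - y)" using frac by (simp add: algebra_simps)
  have "0 \<le> real l * (b - y)" using mult_nonneg_nonneg[of b "real l - real t"] yb ab tl by linarith
  then have by0: "0 \<le> b - y" using tl by (simp add: zero_le_mult_iff)
  have "a * ((L + 1) * (b - y)) \<le> (a + G) * (b - y)"
  proof -
    have "a * (L + 1) \<le> a + G" using ratio aG by (simp add: algebra_simps)
    from mult_right_mono[OF this by0] show ?thesis by (simp only: mult.assoc)
  qed
  with ex have "a * ((L + 1) * (b - y)) \<le> a * b" by linarith
  then have Lb: "(L + 1) * (b - y) \<le> b" using ab by simp
  have "(L + 1) * (b * (real l - real t)) \<le> (L + 1) * (real l * (b - y))"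
    using yb L_ge by (intro mult_left_mono) auto
  also have "\<dots> = real l * ((L + 1) * (b - y))" by simp
  also have "\<dots> \<le> real l * b" using Lb by (intro mult_left_mono) auto
  finally have "b * ((L + 1) * (real l - real t)) \<le> b * real l" by (simp add: algebra_simps)
  then have Ll: "(L + 1) * (real l - real t) \<le> real l" using ab by simp
  \<comment> \<open>\<open>(t + 1)(l - t) \<le> l\<close> amounts to \<open>t(l - t - 1) \<le> 0\<close>\<close>
  have lt1: "l = t + 1"
  proof (rule ccontr)
    assume "l \<noteq> t + 1"
    then have "real l - real t \<ge> 2" using tl by simp
    moreover have "(real t + 1) * (real l - real t) \<le> (L + 1) * (real l - real t)"
      using L_ge tl by (intro mult_right_mono) auto
    then have "real t * (real l - real t - 1) \<le> 0" using Ll by (simp add: algebra_simps)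
    ultimately show False using t1 by (auto simp: mult_le_0_iff)
  qed
  then have "L \<le> real t" using Ll by simp
  then have Lt: "L = real t" using L_ge by simp
  let ?A = "exchange m r l ?P ?P \<A>" let ?B = "exchange n s l ?Q {} \<B>"
  have pc: "prefix_cross t l ?A ?B" by (intro exchange_prefix_cross[OF ij]) auto
  have cA: "card ?A = card \<A> + ((m - l) choose (r - i))"
    using card_exchange[OF _ w(1), of ?P] P by simp
  have "card ?B + card ?Q * ((n - l) choose (s - Suc j)) = card \<B>"
    using sw.card_exchange[OF _ w'(1), of "{}"] by simp
  then have rB: "real (card ?B) = b - y"
    unfolding b_def y_def of_nat_mult[symmetric] by linarith
  have ge: "card \<A> * card \<B> \<le> card ?A * card ?B"
  proof -
    have "a * b \<le> a * ((L + 1) * (b - y))"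
      using yb lt1 Lt ab by (intro mult_left_mono) (auto simp: algebra_simps)
    also have "\<dots> \<le> (a + G) * (b - y)" by fact
    also have "\<dots> = real (card ?A) * real (card ?B)" by (simp add: rB cA a_def G_def)
    finally show ?thesis unfolding a_def b_def of_nat_mult[symmetric] of_nat_le_iff .
  qed
  obtain X' where X': "X' \<in> cylinder {1..m} r {1..l} ?P"
    using class_member[OF ti w, of "{1..<l}"] P by (auto simp: i_def)
  show False
  proof (rule in_stars_impossible[of ?A ?B "{1..<l}"])
    show "X' \<in> ?A \<Longrightarrow> {1..<l} \<subseteq> X'" for X'
      using Xl P unfolding exchange_def cylinder_def by fastforce
    have "X' \<in> ?A" "X' \<inter> {1..l} = {1..<l}"
      using X' P by (auto simp: exchange_def cylinder_def)
    from members_contain[OF pc this] show "Y' \<in> ?B \<Longrightarrow> {1..<l} \<subseteq> Y'" for Y' using lt1 by simp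
    show "t \<le> r" "t \<le> s" using w(1) w'(1) ti tj by auto
  qed (use ge Lt lt1 prefix_cross_imp_cross[OF pc exchange_subset[OF subA]] exchange_subset[OF subA] exchange_subset[OF subB] in auto)
qed

end

text \<open>
  Here \<open>c = l - (i + 1)\<close> and \<open>d = l - (j + 1)\<close> are positive integers with \<open>l = t + c + d\<close>, so the
  conclusion, with its mirror image, means \<open>c = d = 1\<close>. This is where \<open>L > 2 + 2t / 3\<close> is needed: the larger
  deficit \<open>M\<close> satisfies \<open>(L - 2)M \<le> t\<close>, hence \<open>M < 3 / 2\<close>.
\<close>
lemma both_deficits_one:
  fixes c d t L :: real
  assumes "1 \<le> t" "6 + 2 * t < 3 * L" "L * c \<le> t + c + d" "L * d \<le> t + c + d"
  shows "c < 2"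
proof (rule ccontr)
  assume "\<not> c < 2"
  define M where "M = max c d"
  have M2: "2 \<le> M" using \<open>\<not> c < 2\<close> by (simp add: M_def)
  have "L * M \<le> t + 2 * M" using assms(3,4) by (auto simp: M_def max_def)
  then have "(L - 2) * M \<le> t" by (simp add: algebra_simps)
  moreover have "(L - 2) * 2 \<le> (L - 2) * M" using M2 assms(1,2) by (intro mult_left_mono) auto
  ultimately have "(L - 2) * 2 \<le> t" by (rule order_trans[rotated])
  then show False using assms(1,2) by (simp add: algebra_simps)
qed

context reducible_max_pair
begin

text \<open>
  The pivots here are \<open>t\<close>-subsets of \<open>{1..t + 1}\<close>, whose shadow is the single set \<open>{1..t + 1}\<close>. So \<open>p\<close>
  pivots make up at most the fraction \<open>p / (p + 1)\<close> of \<open>\<A>\<close>, which must be at least \<open>1 - 1 / L\<close>.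
\<close>
lemma many_pivots:
  fixes \<P>
  assumes lt: "l = t + 2" and r: "t < r" and pos: "0 < (m - l) choose (r - Suc t)"
    and ne: "pivots t l t \<A> \<B> \<noteq> {}"
    and small: "L * (real (card \<A>) - real (card (pivots t l t \<A> \<B>)) * real ((m - l) choose (r - Suc t)))
      \<le> real (card \<A>)"
  shows "L - 1 \<le> real (card (pivots t l t \<A> \<B>))"
proof -
  define a p G where "a = real (card \<A>)" and "p = card (pivots t l t \<A> \<B>)"
    and "G = (m - l) choose (r - Suc t)"
  obtain D where "D \<subseteq> [{1..<l}]\<^bsup>Suc t\<^esup>"
    and D: "card (pivots t l t \<A> \<B>) * (l - 1 - t) \<le> card D * Suc t"
      "(card (pivots t l t \<A> \<B>) + card D) * ((m - l) choose (r - Suc t)) \<le> card \<A>"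
    by (rule pivots_shadow[OF r])
  have "0 < p" using ne pivots_finite by (simp add: p_def card_gt_0_iff)
  then have "0 < card D" using D(1) lt unfolding p_def[symmetric] by (cases "card D") simp_all
  then have "(p + 1) * G \<le> (p + card D) * G" by (intro mult_right_mono) simp_all
  then have "(p + 1) * G \<le> card \<A>" using D(2) unfolding p_def G_def by linarith
  then have "real ((p + 1) * G) \<le> a" unfolding a_def of_nat_le_iff .
  then have aG: "real G \<le> a - real p * real G" by (simp add: algebra_simps)
  have "(L - 1) * real G \<le> (L - 1) * (a - real p * real G)"
    using aG L_ge t1 by (intro mult_left_mono) simp_all
  also have "\<dots> \<le> real p * real G" using small unfolding a_def p_def G_def by (simp add: algebra_simps)
  finally show ?thesis using pos unfolding p_def G_def by simp
qed

text \<open>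
  At most \<open>t + 1\<close> pivots exist. All but one of them are given up, at a cost of at most \<open>t\<close> classes,
  and \<open>Z\<close> without \<open>l\<close> is worth at least \<open>L\<close> of these classes.
\<close>
lemma exchange_one_gain:
  assumes lt: "l = t + 2" and r: "t < r" and pos: "0 < (m - l) choose (r - Suc t)"
    and Z: "Z \<in> pivots t l t \<A> \<B>"
  defines "\<A>' \<equiv> exchange m r l (pivots t l t \<A> \<B>) {Z} \<A>"
  shows "card \<A> \<le> card \<A>'" "real t < L \<Longrightarrow> card \<A> < card \<A>'"
proof -
  define p G' G where "p = card (pivots t l t \<A> \<B>)" and "G' = (m - l) choose (r - Suc t)"
    and "G = (m - l) choose (r - t)"
  have sub: "pivots t l t \<A> \<B> \<subseteq> [{1..<l}]\<^bsup>t\<^esup>" unfolding pivots_def by blast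
  have "p \<le> card ([{1..<l}]\<^bsup>t\<^esup>)"
    unfolding p_def by (intro card_mono sub) (simp add: finite_imp_finite_nsets)
  also have "\<dots> = t + 1" using lt by simp
  finally have p: "p \<le> t + 1" .
  have c: "card (pivots t l t \<A> \<B> - {Z}) = p - 1" using Z by (simp add: p_def card_Diff_singleton)
  have e: "card \<A>' + (p - 1) * G' = card \<A> + G"
    using card_exchange[of "{Z}" t] Z r c unfolding \<A>'_def G_def G'_def by simp
  have "(p - 1) * G' \<le> t * G'" using p by (intro mult_right_mono) simp_all
  then have le: "real ((p - 1) * G') \<le> real t * real G'" unfolding of_nat_mult[symmetric] of_nat_le_iff .
  have ratio: "L * real G' \<le> real G" unfolding G_def G'_def by (rule class_ratio[OF order_refl r])
  have "real t * real G' \<le> L * real G'" using L_ge by (intro mult_right_mono) simp_all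
  then have "(p - 1) * G' \<le> G" using le ratio by linarith
  then show "card \<A> \<le> card \<A>'" using e by linarith
  assume "real t < L"
  then have "real t * real G' < L * real G'" using pos by (simp add: G'_def)
  then have "(p - 1) * G' < G" using le ratio by linarith
  then show "card \<A> < card \<A>'" using e by linarith
qed

text \<open>
  Two members sharing fewer than \<open>t\<close> elements below \<open>l\<close> both contain \<open>l\<close>, so each provides a pivot. The
  two one-sided exchanges confine the sizes of the pivots to \<open>i = j = t\<close>, and there the exchange
  that keeps a common pivot \<open>Z\<close> does not decrease either family.
\<close>
lemma prefix_cross_pred: "prefix_cross t (l - 1) \<A> \<B>"
proof (rule ccontr)
  assume "\<not> ?thesis"
  interpret sw: reducible_max_pair n s m r t l \<B> \<A> L by (rule reducible_swap)
  have l1: "{1..l - 1} = {1..<l}" using tl by auto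
  from \<open>\<not> ?thesis\<close> obtain X Y where XY: "X \<in> \<A>" "Y \<in> \<B>" and lt: "card (X \<inter> Y \<inter> {1..<l}) < t"
    unfolding prefix_cross_def l1 by (auto simp: not_le)
  have lXY: "l \<in> X \<inter> Y"
  proof (rule ccontr)
    assume "l \<notin> X \<inter> Y"
    then have "X \<inter> Y \<inter> {1..l} = X \<inter> Y \<inter> {1..<l}" unfolding l_split by blast
    then show False using prefixD[OF XY] lt by simp
  qed
  then have X: "X \<in> \<A>" "l \<in> X" and Y: "Y \<in> \<B>" "l \<in> Y" using XY by auto
  have lt': "card (Y \<inter> X \<inter> {1..<l}) < t" using lt by (simp add: Int_commute)
  define i j where "i = card (X \<inter> {1..<l})" and "j = card (Y \<inter> {1..<l})"
  have ij: "i + j + 2 = l + t" unfolding i_def j_def by (rule pivotal_pair_union[OF X Y lt])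
  then have ji: "j + i + 2 = l + t" by simp
  have "i \<le> card {1..<l}" "j \<le> card {1..<l}" unfolding i_def j_def by (intro card_mono; simp)+
  then have il: "i < l" "j < l" using tl by auto
  have "j + 1 \<noteq> t" using degenerate_pivot_impossible[OF X Y lt] unfolding j_def by blast
  moreover have "i + 1 \<noteq> t" using sw.degenerate_pivot_impossible[OF Y X lt'] unfolding i_def by blast
  ultimately have ti: "t \<le> i" and tj: "t \<le> j" using ij il by auto
  note w = class_weight_pos[OF X i_def[symmetric]] and w' = sw.class_weight_pos[OF Y j_def[symmetric]]
  let ?P = "pivots t l i \<A> \<B>" let ?Q = "pivots t l j \<B> \<A>"
  have "?P \<noteq> {}"
  proof -
    have "X \<inter> {1..l} = insert l (X \<inter> {1..<l})" using X(2) l_split by blast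
    moreover have "X \<inter> {1..<l} \<inter> Y = X \<inter> Y \<inter> {1..<l}" by blast
    ultimately have "X \<inter> {1..<l} \<in> ?P"
      using X(1) Y lt unfolding pivots_def nsets_def mem_Collect_eq i_def by (metis Int_lower2 finite_Int finite_atLeastLessThan)
    then show ?thesis by blast
  qed
  have "?Q \<noteq> {}"
  proof -
    have "Y \<inter> {1..l} = insert l (Y \<inter> {1..<l})" using Y(2) l_split by blast
    moreover have "Y \<inter> {1..<l} \<inter> X = X \<inter> Y \<inter> {1..<l}" by blast
    ultimately have "Y \<inter> {1..<l} \<in> ?Q"
      using Y(1) X lt unfolding pivots_def nsets_def mem_Collect_eq j_def by (metis Int_lower2 finite_Int finite_atLeastLessThan)
    then show ?thesis by blast
  qed
  define a b x y where "a = real (card \<A>)" and "b = real (card \<B>)"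
    and "x = real (card ?P) * real ((m - l) choose (r - Suc i))"
    and "y = real (card ?Q) * real ((n - l) choose (s - Suc j))"
  have pq: "0 < card ?P" "0 < card ?Q"
    using \<open>?P \<noteq> {}\<close> \<open>?Q \<noteq> {}\<close> pivots_finite by (simp_all add: card_gt_0_iff)
  have pos: "0 < a" "0 < b" "0 < x" "0 < y"
    using card_posA sw.card_posA w(2) w'(2) pq unfolding a_def b_def x_def y_def by simp_all
  have fx: "x * real l \<le> a * real (Suc i)" and fy: "y * real l \<le> b * real (Suc j)"
    unfolding a_def b_def x_def y_def
    by (rule pivot_fraction[OF w(1) il(1)], rule sw.pivot_fraction[OF w'(1) il(2)])
  have "a * real (Suc i) \<le> a * real l" "b * real (Suc j) \<le> b * real l"
    using il pos by (intro mult_left_mono; simp)+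
  with fx fy have "x * real l \<le> a * real l" "y * real l \<le> b * real l" by linarith+
  then have xa: "x \<le> a" and yb: "y \<le> b" using tl by simp_all
  have L0: "0 \<le> L" using L_ge by linarith
  have "L * x \<le> real (card ?P) * real ((m - l) choose (r - i))"
    using mult_left_mono[OF class_ratio[OF ti w(1)], of "real (card ?P)"] unfolding x_def by (simp add: mult.left_commute)
  then have "(a + L * x) * (b - y) \<le> (a + real (card ?P) * real ((m - l) choose (r - i))) * (b - y)"
    using yb by (intro mult_right_mono) simp_all
  also have "\<dots> \<le> a * b" unfolding a_def b_def y_def by (rule exchange_left[OF ij w(1) w'(1)])
  finally have e1: "(a + L * x) * (b - y) \<le> a * b" .
  have "L * y \<le> real (card ?Q) * real ((n - l) choose (s - j))"
    using mult_left_mono[OF sw.class_ratio[OF tj w'(1)], of "real (card ?Q)"] unfolding y_def by (simp add: mult.left_commute)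
  then have "(b + L * y) * (a - x) \<le> (b + real (card ?Q) * real ((n - l) choose (s - j))) * (a - x)"
    using xa by (intro mult_right_mono) simp_all
  also have "\<dots> \<le> b * a" unfolding a_def b_def x_def by (rule sw.exchange_left[OF ji w'(1) w(1)])
  finally have e2: "(b + L * y) * (a - x) \<le> b * a" .
  have sx: "L * (a - x) \<le> a"
    using exchange_balance[OF pos xa yb L0 e1] e2 by (simp add: mult.commute)
  have sy: "L * (b - y) \<le> b"
    using exchange_balance[OF pos(2,1,4,3) yb xa L0 e2] e1 by (simp add: mult.commute)
  define c d where "c = real l - real (Suc i)" and "d = real l - real (Suc j)"
  have l_eq: "real l = real t + c + d" using ij unfolding c_def d_def by simp
  have deficit: "L * (real l - k) \<le> real l" if "L * (a' - x') \<le> a'" "x' * real l \<le> a' * k" "0 < a'" for a' x' k :: real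
  proof -
    have "a' * (real l - k) \<le> real l * (a' - x')" using that(2) by (simp add: algebra_simps)
    then have "L * (a' * (real l - k)) \<le> L * (real l * (a' - x'))" using L0 by (rule mult_left_mono)
    also have "\<dots> = real l * (L * (a' - x'))" by (rule mult.left_commute)
    also have "\<dots> \<le> real l * a'" using that(1) by (intro mult_left_mono) simp_all
    finally have "a' * (L * (real l - k)) \<le> a' * real l" by (simp add: mult.commute mult.left_commute)
    then show ?thesis using that(3) by simp
  qed
  have "L * c \<le> real t + c + d" "L * d \<le> real t + c + d"
    using deficit[OF sx fx pos(1)] deficit[OF sy fy pos(2)] unfolding c_def[symmetric] d_def[symmetric] l_eq[symmetric] .
  moreover have "1 \<le> real t" using t1 by simp
  ultimately have "c < 2" "d < 2"
    using both_deficits_one[of "real t" L c d] both_deficits_one[of "real t" L d c] L_gt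
    by (simp_all add: ac_simps)
  then have "l < i + 3" "l < j + 3" unfolding c_def d_def by linarith+
  then have it: "i = t" and jt: "j = t" and lt2: "l = t + 2" using ij ti tj by simp_all
  have P_many: "L - 1 \<le> real (card ?P)"
    using many_pivots[OF lt2] w \<open>?P \<noteq> {}\<close> sx unfolding a_def x_def it by blast
  have Q_many: "L - 1 \<le> real (card ?Q)"
    using sw.many_pivots[OF lt2] w' \<open>?Q \<noteq> {}\<close> sy unfolding b_def y_def jt by blast
  \<comment> \<open>\<open>2(L - 1) > 2 + 4t / 3 > t + 1\<close>, the number of \<open>t\<close>-subsets of \<open>{1..t + 1}\<close>\<close>
  have "?P \<inter> ?Q \<noteq> {}"
  proof
    assume "?P \<inter> ?Q = {}"
    then have "card ?P + card ?Q = card (?P \<union> ?Q)"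
      by (intro card_Un_disjoint[symmetric] pivots_finite)
    also have "\<dots> \<le> card ([{1..<l}]\<^bsup>t\<^esup>)"
      unfolding it jt by (intro card_mono) (auto simp: finite_imp_finite_nsets pivots_def)
    also have "\<dots> = t + 1" using lt2 by simp
    finally show False using P_many Q_many L_gt t1 by linarith
  qed
  then obtain Z where Z: "Z \<in> pivots t l t \<A> \<B>" "Z \<in> pivots t l t \<B> \<A>" unfolding it jt by blast
  note Z' = pivotsD[OF Z(1)]
  let ?A = "exchange m r l (pivots t l t \<A> \<B>) {Z} \<A>"
  let ?B = "exchange n s l (pivots t l t \<B> \<A>) {Z} \<B>"
  have pc: "prefix_cross t l ?A ?B"
  proof (rule exchange_prefix_cross)
    show "t + t + 2 = l + t" using lt2 by simp
    show "\<And>S R. S \<in> {Z} \<Longrightarrow> R \<in> {Z} \<Longrightarrow> t \<le> card (S \<inter> R)" using Z' by simp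
  qed (use Z in simp_all)
  have wr: "t < r" "0 < (m - l) choose (r - Suc t)" and ws: "t < s" "0 < (n - l) choose (s - Suc t)"
    using w w' unfolding it jt by blast+
  obtain X' where "X' \<in> cylinder {1..m} r {1..l} {Z}"
    by (rule class_member[OF order_refl wr Z'(1,2)])
  then have X': "X' \<in> ?A" "X' \<inter> {1..l} = Z" unfolding exchange_def cylinder_def by simp_all
  obtain Y' where "Y' \<in> cylinder {1..n} s {1..l} {Z}"
    by (rule sw.class_member[OF order_refl ws Z'(1,2)])
  then have Y': "Y' \<in> ?B" "Y' \<inter> {1..l} = Z" unfolding exchange_def cylinder_def by simp_all
  note gA = exchange_one_gain[OF lt2 wr Z(1)] and gB = sw.exchange_one_gain[OF lt2 ws Z(2)]
  show False
  proof (rule in_stars_impossible[of ?A ?B Z])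
    show "Z \<subseteq> W" if "W \<in> ?B" for W by (rule members_contain[OF pc X' Z'(2) that])
    show "Z \<subseteq> W" if "W \<in> ?A" for W
      by (rule members_contain[OF prefix_cross_commute[OF pc] Y' Z'(2) that])
    show "card \<A> * card \<B> \<le> card ?A * card ?B" by (intro mult_le_mono gA(1) gB(1))
    show "card \<A> * card \<B> < card ?A * card ?B" if "real t < L"
      by (rule mult_strict_mono[OF gA(2)[OF that] gB(2)[OF that]]) (use gA(2)[OF that] in simp_all)
    show "Z \<subseteq> {1..l}" using Z'(1) by auto
  qed (use Z'(2) wr(1) ws(1) prefix_cross_imp_cross[OF pc exchange_subset[OF subA]]
        exchange_subset[OF subA] exchange_subset[OF subB] in simp_all)
qed

end

section \<open>Compression\<close>

definition shift_set :: "nat \<Rightarrow> nat \<Rightarrow> nat set set \<Rightarrow> nat set \<Rightarrow> nat set"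
  where "shift_set i j \<A> X =
    (if j \<in> X \<and> i \<notin> X \<and> insert i (X - {j}) \<notin> \<A> then insert i (X - {j}) else X)"

lemma shift_set_moved:
  assumes "shift_set i j \<A> X \<noteq> X"
  shows "j \<in> X" "i \<notin> X" "shift_set i j \<A> X = insert i (X - {j})"
  using assms unfolding shift_set_def by presburger+

lemma inj_on_shift_set: "inj_on (shift_set i j \<A>) \<A>"
proof (rule inj_onI)
  fix X Y assume XY: "X \<in> \<A>" "Y \<in> \<A>" and eq: "shift_set i j \<A> X = shift_set i j \<A> Y"
  have inv: "insert j (insert i (W - {j}) - {i}) = W" if "j \<in> W" "i \<notin> W" for W
    using that by auto
  let ?mv = "\<lambda>W. j \<in> W \<and> i \<notin> W \<and> insert i (W - {j}) \<notin> \<A>"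
  show "X = Y"
  proof (cases "?mv X"; cases "?mv Y")
    assume X: "?mv X" and Y: "?mv Y"
    then have "insert i (X - {j}) = insert i (Y - {j})"
      using eq unfolding shift_set_def if_P[OF X] if_P[OF Y] by blast
    then show "X = Y" using inv[of X] inv[of Y] X Y by simp
  next
    assume X: "?mv X" and Y: "\<not> ?mv Y"
    have "insert i (X - {j}) = Y" using eq unfolding shift_set_def if_P[OF X] if_not_P[OF Y] .
    then show "X = Y" using X XY by blast
  next
    assume X: "\<not> ?mv X" and Y: "?mv Y"
    have "X = insert i (Y - {j})" using eq unfolding shift_set_def if_not_P[OF X] if_P[OF Y] .
    then show "X = Y" using Y XY by blast
  next
    assume X: "\<not> ?mv X" and Y: "\<not> ?mv Y"
    show "X = Y" using eq unfolding shift_set_def if_not_P[OF X] if_not_P[OF Y] .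
  qed
qed

lemma card_shift: "card (shift_set i j \<A> ` \<A>) = card \<A>"
  by (rule card_image[OF inj_on_shift_set])

lemma shift_subset:
  assumes A: "\<A> \<subseteq> [{1..m}]\<^bsup>r\<^esup>" and ij: "1 \<le> i" "i < j"
  shows "shift_set i j \<A> ` \<A> \<subseteq> [{1..m}]\<^bsup>r\<^esup>"
proof (rule image_subsetI)
  fix X assume "X \<in> \<A>"
  then have X: "X \<subseteq> {1..m}" "finite X" "card X = r" using A by (auto simp: nsets_def)
  show "shift_set i j \<A> X \<in> [{1..m}]\<^bsup>r\<^esup>"
  proof (cases "j \<in> X \<and> i \<notin> X")
    case True
    then have "card (insert i (X - {j})) = r"
      using X card_Suc_Diff1[of X j] by simp
    moreover have "insert i (X - {j}) \<subseteq> {1..m}" using True X ij by auto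
    ultimately show ?thesis using X unfolding shift_set_def nsets_def by simp
  qed (use X in \<open>auto simp: shift_set_def nsets_def\<close>)
qed

text \<open>
  If \<open>X\<close> stays in place although \<open>j\<close> could be replaced by \<open>i\<close> in it, this is because the replaced set is
  a member as well; that member meets \<open>Y\<close> in the same number of elements as \<open>X\<close> meets the shifted \<open>Y\<close>.
\<close>
lemma shift_cross_half:
  assumes fin: "\<And>X. X \<in> \<A> \<Longrightarrow> finite X" and cr: "cross_intersecting t \<A> \<B>"
    and X: "X \<in> \<A>" "shift_set i j \<A> X = X" and Y: "Y \<in> \<B>" "j \<in> Y" "i \<notin> Y" and ij: "i \<noteq> j"
  shows "t \<le> card (X \<inter> insert i (Y - {j}))"
proof (cases "j \<in> X \<and> i \<notin> X")
  case True
  then have "insert i (X - {j}) \<in> \<A>" using X unfolding shift_set_def by (cases "insert i (X - {j}) \<in> \<A>") auto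
  then have "t \<le> card (insert i (X - {j}) \<inter> Y)" using cr Y unfolding cross_intersecting_def by blast
  moreover have "insert i (X - {j}) \<inter> Y = X \<inter> insert i (Y - {j})" using True Y by auto
  ultimately show ?thesis by simp
next
  case False
  have t: "t \<le> card (X \<inter> Y)" using cr X Y unfolding cross_intersecting_def by blast
  show ?thesis
  proof (cases "j \<in> X")
    case True
    then have "X \<inter> insert i (Y - {j}) = insert i (X \<inter> Y - {j})" using False by auto
    moreover have "card (insert i (X \<inter> Y - {j})) = card (X \<inter> Y)"
      using True Y fin[OF X(1)] card_Suc_Diff1[of "X \<inter> Y" j] by simp
    ultimately show ?thesis using t by simp
  next
    case False
    then have "X \<inter> Y \<subseteq> X \<inter> insert i (Y - {j})" by auto
    then have "card (X \<inter> Y) \<le> card (X \<inter> insert i (Y - {j}))" using fin[OF X(1)] by (intro card_mono) auto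
    then show ?thesis using t by simp
  qed
qed

lemma shift_cross:
  assumes finA: "\<And>X. X \<in> \<A> \<Longrightarrow> finite X" and finB: "\<And>Y. Y \<in> \<B> \<Longrightarrow> finite Y"
    and cr: "cross_intersecting t \<A> \<B>" and ij: "i \<noteq> j"
  shows "cross_intersecting t (shift_set i j \<A> ` \<A>) (shift_set i j \<B> ` \<B>)"
  unfolding cross_intersecting_def
proof clarify
  fix X Y assume X: "X \<in> \<A>" and Y: "Y \<in> \<B>"
  have t: "t \<le> card (X \<inter> Y)" using cr X Y unfolding cross_intersecting_def by blast
  show "t \<le> card (shift_set i j \<A> X \<inter> shift_set i j \<B> Y)"
  proof (cases "shift_set i j \<A> X = X"; cases "shift_set i j \<B> Y = Y")
    assume "shift_set i j \<A> X = X" "shift_set i j \<B> Y = Y"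
    then show ?thesis using t by simp
  next
    assume a: "shift_set i j \<A> X = X" and b: "shift_set i j \<B> Y \<noteq> Y"
    then show ?thesis using shift_cross_half[OF finA cr X a Y] shift_set_moved[OF b] ij by simp
  next
    assume a: "shift_set i j \<A> X \<noteq> X" and b: "shift_set i j \<B> Y = Y"
    then show ?thesis
      using shift_cross_half[OF finB cross_intersecting_commute[OF cr] Y b X] shift_set_moved[OF a] ij
      by (simp add: Int_commute)
  next
    assume a: "shift_set i j \<A> X \<noteq> X" and b: "shift_set i j \<B> Y \<noteq> Y"
    note a' = shift_set_moved[OF a] and b' = shift_set_moved[OF b]
    have "shift_set i j \<A> X \<inter> shift_set i j \<B> Y = insert i (X \<inter> Y - {j})" using a' b' by auto
    moreover have "card (insert i (X \<inter> Y - {j})) = card (X \<inter> Y)"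
      using a' b' finA[OF X] card_Suc_Diff1[of "X \<inter> Y" j] by simp
    ultimately show ?thesis using t by simp
  qed
qed

lemma shift_max_pair:
  assumes max: "max_pair t m r n s \<A> \<B>" and ij: "1 \<le> i" "i < j"
  shows "max_pair t m r n s (shift_set i j \<A> ` \<A>) (shift_set i j \<B> ` \<B>)"
proof -
  have A: "\<A> \<subseteq> [{1..m}]\<^bsup>r\<^esup>" and B: "\<B> \<subseteq> [{1..n}]\<^bsup>s\<^esup>" and cr: "cross_intersecting t \<A> \<B>"
    using max unfolding max_pair_def by blast+
  have "\<And>X. X \<in> \<A> \<Longrightarrow> finite X" "\<And>Y. Y \<in> \<B> \<Longrightarrow> finite Y" using A B by (auto simp: nsets_def)
  then have "cross_intersecting t (shift_set i j \<A> ` \<A>) (shift_set i j \<B> ` \<B>)"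
    using ij by (intro shift_cross[OF _ _ cr]) simp_all
  with shift_subset[OF A ij] shift_subset[OF B ij] max
  show ?thesis unfolding max_pair_def card_shift by blast
qed

text \<open>
  This potential decreases under every compression to the left that changes the family, so compressing ends.
\<close>
definition weight :: "nat set set \<Rightarrow> nat" where "weight \<A> = (\<Sum>X\<in>\<A>. \<Sum>X)"

lemma shift_set_sum_le:
  assumes "finite X" "i < j"
  shows "\<Sum>(shift_set i j \<A> X) \<le> \<Sum>X" "shift_set i j \<A> X \<noteq> X \<Longrightarrow> \<Sum>(shift_set i j \<A> X) < \<Sum>X"
proof -
  show lt: "\<Sum>(shift_set i j \<A> X) < \<Sum>X" if "shift_set i j \<A> X \<noteq> X"
    using shift_set_moved[OF that] assms sum.remove[of X j "\<lambda>x. x"] by simp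
  then show "\<Sum>(shift_set i j \<A> X) \<le> \<Sum>X" by (cases "shift_set i j \<A> X = X") simp_all
qed

lemma weight_shift:
  assumes fin: "finite \<A>" "\<And>X. X \<in> \<A> \<Longrightarrow> finite X" and ij: "i < j"
  shows "weight (shift_set i j \<A> ` \<A>) \<le> weight \<A>"
    "X \<in> \<A> \<Longrightarrow> shift_set i j \<A> X \<noteq> X \<Longrightarrow> weight (shift_set i j \<A> ` \<A>) < weight \<A>"
proof -
  have e: "weight (shift_set i j \<A> ` \<A>) = (\<Sum>X\<in>\<A>. \<Sum>(shift_set i j \<A> X))"
    unfolding weight_def by (simp add: sum.reindex[OF inj_on_shift_set])
  have le: "\<Sum>(shift_set i j \<A> Y) \<le> \<Sum>Y" if "Y \<in> \<A>" for Y
    using shift_set_sum_le(1)[OF fin(2)[OF that] ij] .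
  show "weight (shift_set i j \<A> ` \<A>) \<le> weight \<A>"
    unfolding e unfolding weight_def by (rule sum_mono[OF le])
  assume X: "X \<in> \<A>" "shift_set i j \<A> X \<noteq> X"
  have "\<exists>Y\<in>\<A>. \<Sum>(shift_set i j \<A> Y) < \<Sum>Y"
    using shift_set_sum_le(2)[OF fin(2)[OF X(1)] ij X(2)] X(1) by blast
  then show "weight (shift_set i j \<A> ` \<A>) < weight \<A>"
    unfolding e unfolding weight_def using le by (intro sum_strict_mono_ex1 fin(1)) blast+
qed

lemma not_left_shifted:
  assumes "\<not> left_shifted \<A>"
  obtains i j X where "1 \<le> i" "i < j" "X \<in> \<A>" "shift_set i j \<A> X \<noteq> X"
proof -
  from assms obtain X i j where "X \<in> \<A>" "j \<in> X" "1 \<le> i" "i < j" "i \<notin> X" "insert i (X - {j}) \<notin> \<A>"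
    unfolding left_shifted_def by blast
  moreover from this have "shift_set i j \<A> X = insert i (X - {j})" unfolding shift_set_def by simp
  ultimately show ?thesis using that[of i j X] by blast
qed

section \<open>Undoing a compression of stars\<close>

text \<open>
  The set \<open>R\<close> extends the kernel \<open>T\<close> by elements outside \<open>U\<close>; it serves to build members that meet given sets
  in as few elements as possible.
\<close>
lemma obtain_sunflower_petal:
  fixes V :: "'a set"
  assumes "finite V" "T \<subseteq> V" "T \<subseteq> U" "finite U" "card U + (k - card T) \<le> card V" "card T \<le> k"
  obtains R where "R \<subseteq> V" "finite R" "card R = k" "T \<subseteq> R" "R \<inter> U = T"
proof -
  have "card (V - U) \<ge> card V - card U" using assms(4) by (rule diff_card_le_card_Diff)
  then have "k - card T \<le> card (V - U)" using assms(5) by linarith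
  then obtain R0 where R0: "R0 \<subseteq> V - U" "card R0 = k - card T" "finite R0"
    by (rule obtain_subset_with_card_n)
  have fT: "finite T" using assms(1,2) finite_subset by blast
  have "T \<inter> R0 = {}" using R0(1) assms(3) by blast
  then have "card (T \<union> R0) = k" using R0 fT assms(6) card_Un_disjoint[of T R0] by simp
  moreover have "T \<union> R0 \<subseteq> V" "finite (T \<union> R0)" "(T \<union> R0) \<inter> U = T" using R0 assms(2,3) fT by blast+
  ultimately show ?thesis using that[of "T \<union> R0"] by blast
qed

lemma star_fiber:
  assumes S: "shift_set i j \<F> ` \<F> = {X \<in> [{1..m}]\<^bsup>r\<^esup>. T \<subseteq> X}"
    and i: "i \<in> {1..m}" "i \<in> T" and R: "R \<subseteq> {1..m}" "finite R" "Suc (card R) = r" "T - {i} \<subseteq> R" "i \<notin> R"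
  shows "insert i R \<in> \<F> \<or> insert j R \<in> \<F>"
proof -
  have "insert i R \<in> {X \<in> [{1..m}]\<^bsup>r\<^esup>. T \<subseteq> X}" using i R unfolding nsets_def by auto
  then obtain Y where Y: "Y \<in> \<F>" "shift_set i j \<F> Y = insert i R" unfolding S[symmetric] by auto
  show ?thesis
  proof (cases "shift_set i j \<F> Y = Y")
    case False
    note mv = shift_set_moved[OF False]
    have "Y - {j} = R" using mv(2,3) Y(2) R(5) by (metis Diff_iff insert_ident)
    then have "insert j R = Y" using mv(1) by blast
    then show ?thesis using Y(1) by simp
  qed (use Y in simp)
qed

definition common_kernel :: "nat \<Rightarrow> nat set set \<Rightarrow> nat set set \<Rightarrow> bool"
  where "common_kernel t \<A> \<B> \<longleftrightarrow> (\<exists>T. card T = t \<and> (\<forall>X\<in>\<A>. T \<subseteq> X) \<and> (\<forall>Y\<in>\<B>. T \<subseteq> Y))"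

lemma moved_member_of_shifted_star:
  assumes S: "shift_set i j \<F> ` \<F> = {X \<in> [{1..m}]\<^bsup>r\<^esup>. T \<subseteq> X}" and X: "X \<in> \<F>" "\<not> T \<subseteq> X" and ij: "i \<noteq> j"
  shows "i \<in> T" "j \<notin> T" "i \<notin> X" "j \<in> X" "T - {i} \<subseteq> X"
proof -
  have "shift_set i j \<F> X \<in> {X \<in> [{1..m}]\<^bsup>r\<^esup>. T \<subseteq> X}" using X(1) unfolding S[symmetric] by blast
  then have T: "T \<subseteq> shift_set i j \<F> X" by blast
  then have ne: "shift_set i j \<F> X \<noteq> X" using X(2) by metis
  note mv = shift_set_moved[OF ne]
  show "i \<notin> X" "j \<in> X" by fact+
  have "T \<subseteq> insert i (X - {j})" using T unfolding mv(3) .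
  then show "i \<in> T" "j \<notin> T" "T - {i} \<subseteq> X" using X(2) ij by blast+
qed

text \<open>
  The kernel of the stars stays a kernel unless \<open>i \<in> T\<close> and \<open>j \<notin> T\<close>. In that case every member
  contains \<open>T\<^sub>0 = T - {i}\<close> and at least one of \<open>i\<close>, \<open>j\<close>. Since the compressed families are full stars, for every
  \<open>R \<supseteq> T\<^sub>0\<close> of the right size avoiding \<open>i\<close> and \<open>j\<close> one of \<open>insert i R\<close>, \<open>insert j R\<close> was a member
  before. If some member of either family lacks \<open>i\<close> and another one, in the same or in the other
  family, lacks \<open>j\<close>, then a set \<open>R\<close> meeting the relevant members only in \<open>T\<^sub>0\<close> produces a member that
  shares merely \<open>t - 1\<close> elements with one of them. So all members contain \<open>T\<close>, or all contain
  \<open>insert j T\<^sub>0\<close>.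
\<close>
lemma unshift_common_kernel:
  assumes A: "\<A> \<subseteq> [{1..m}]\<^bsup>r\<^esup>" and B: "\<B> \<subseteq> [{1..n}]\<^bsup>s\<^esup>" and cr: "cross_intersecting t \<A> \<B>"
    and T: "card T = t" "T \<subseteq> {1..m}" "T \<subseteq> {1..n}"
    and SA: "shift_set i j \<A> ` \<A> = {X \<in> [{1..m}]\<^bsup>r\<^esup>. T \<subseteq> X}"
    and SB: "shift_set i j \<B> ` \<B> = {Y \<in> [{1..n}]\<^bsup>s\<^esup>. T \<subseteq> Y}"
    and ij: "1 \<le> i" "i < j" and t: "1 \<le> t" "t \<le> r" "t \<le> s"
    and room: "2 * r + s + 1 \<le> n + 2 * t" "r + s + 1 \<le> m + t"
  shows "common_kernel t \<A> \<B>"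
proof (cases "(\<forall>X\<in>\<A>. T \<subseteq> X) \<and> (\<forall>Y\<in>\<B>. T \<subseteq> Y)")
  case True
  then show ?thesis using T unfolding common_kernel_def by auto
next
  case False
  have ne: "i \<noteq> j" using ij by simp
  note cA = moved_member_of_shifted_star[OF SA _ _ ne] and cB = moved_member_of_shifted_star[OF SB _ _ ne]
  define T0 where "T0 = T - {i}"
  have iT: "i \<in> T" "j \<notin> T" using False cA cB by blast+
  have fT: "finite T" using finite_subset[OF T(2)] by simp
  have cT0: "Suc (card T0) = t" "finite T0" using iT T(1) fT card_Suc_Diff1[of T i] unfolding T0_def by simp_all
  have T0A: "T0 \<subseteq> X" if "X \<in> \<A>" for X using cA(5)[OF that] unfolding T0_def by blast
  have T0B: "T0 \<subseteq> Y" if "Y \<in> \<B>" for Y using cB(5)[OF that] unfolding T0_def by blast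
  have memA: "finite X" "card X = r" if "X \<in> \<A>" for X using A that unfolding nsets_def by blast+
  have memB: "finite Y" "card Y = s" if "Y \<in> \<B>" for Y using B that unfolding nsets_def by blast+
  have bad: False if "X \<in> \<A>" "Y \<in> \<B>" "X \<inter> Y = T0" for X Y
    using cr that cT0 unfolding cross_intersecting_def by fastforce
  have T0V: "T0 \<subseteq> {1..m} - {i, j}" "T0 \<subseteq> {1..n} - {i, j}" using T iT unfolding T0_def by blast+
  have cV: "k \<le> card ({1..k} - {i, j}) + 2" for k :: nat
    using diff_card_le_card_Diff[of "{i, j}" "{1..k}"] ne by simp
  have typeA: "(\<forall>X\<in>\<A>. T \<subseteq> X) \<or> (\<forall>X\<in>\<A>. j \<in> X)"
  proof (rule ccontr)
    assume "\<not> ?thesis"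
    then obtain X1 X2 where X: "X1 \<in> \<A>" "\<not> T \<subseteq> X1" "X2 \<in> \<A>" "j \<notin> X2" by blast
    note X1 = cA[OF X(1,2)]
    have "T \<subseteq> X2" using cA(4)[OF X(3)] X(4) by blast
    then have iX2: "i \<in> X2" using iT by blast
    define U where "U = (X1 - {j}) \<union> (X2 - {i})"
    have "T0 \<subseteq> X1 - {j}" "T0 \<subseteq> X2 - {i}"
      using T0A[OF X(1)] T0A[OF X(3)] iT unfolding T0_def by blast+
    then have T0U: "T0 \<subseteq> (X1 - {j}) \<inter> (X2 - {i})" by blast
    have fU: "finite (X1 - {j})" "finite (X2 - {i})" using memA X by simp_all
    have "Suc (card (X1 - {j})) = r" "Suc (card (X2 - {i})) = r"
      using card_Suc_Diff1[of X1 j] card_Suc_Diff1[of X2 i] memA[OF X(1)] memA[OF X(3)] X1(4) iX2 by simp_all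
    moreover have "card T0 \<le> card ((X1 - {j}) \<inter> (X2 - {i}))" using T0U fU by (intro card_mono) simp_all
    moreover have "card U + card ((X1 - {j}) \<inter> (X2 - {i})) = card (X1 - {j}) + card (X2 - {i})"
      unfolding U_def using card_Un_Int[OF fU] by simp
    ultimately have "card U + t + 1 \<le> 2 * r" using cT0(1) by linarith
    then have "card U + ((s - 1) - card T0) \<le> card ({1..n} - {i, j})"
      using cV[of n] room(1) cT0(1) t by linarith
    moreover have "finite U" "T0 \<subseteq> U" "card T0 \<le> s - 1"
      using fU T0U cT0(1) t unfolding U_def by (simp, blast, linarith)
    ultimately obtain R where R: "R \<subseteq> {1..n} - {i, j}" "finite R" "card R = s - 1" "T0 \<subseteq> R" "R \<inter> U = T0"
      using obtain_sunflower_petal[of "{1..n} - {i, j}" T0 U "s - 1"] T0V(2) by blast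
    have "insert i R \<in> \<B> \<or> insert j R \<in> \<B>"
    proof (rule star_fiber[OF SB _ iT(1)])
      show "i \<in> {1..n}" using iT(1) T(3) by blast
      show "R \<subseteq> {1..n}" "finite R" "i \<notin> R" using R(1,2) by blast+
      show "Suc (card R) = s" using R(3) t by simp
      show "T - {i} \<subseteq> R" using R(4) unfolding T0_def .
    qed
    moreover have "X1 \<inter> insert i R = T0" "X2 \<inter> insert j R = T0"
    proof -
      have "X1 \<inter> R \<subseteq> R \<inter> U" "X2 \<inter> R \<subseteq> R \<inter> U" using R(1) unfolding U_def by blast+
      then have "X1 \<inter> R \<subseteq> T0" "X2 \<inter> R \<subseteq> T0" unfolding R(5) .
      moreover have "T0 \<subseteq> X1 \<inter> R" "T0 \<subseteq> X2 \<inter> R"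
        using R(4) T0A[OF X(1)] T0A[OF X(3)] by simp_all
      ultimately have "X1 \<inter> R = T0" "X2 \<inter> R = T0" by (simp_all add: subset_antisym)
      then show "X1 \<inter> insert i R = T0" "X2 \<inter> insert j R = T0" using X1(3) X(4) by blast+
    qed
    ultimately show False using bad[OF X(1)] bad[OF X(3)] by blast
  qed
  have petal: "\<exists>R. R \<subseteq> {1..m} - {i, j} \<and> R \<inter> Y = T0 \<and> (insert i R \<in> \<A> \<or> insert j R \<in> \<A>)"
    if Y: "Y \<in> \<B>" "i \<in> Y \<or> j \<in> Y" for Y
  proof -
    define U where "U = Y - {i, j}"
    have fU: "finite U" using memB[OF Y(1)] unfolding U_def by simp
    have "U \<subset> Y" using Y(2) unfolding U_def by blast
    then have "card U < s" using psubset_card_mono[OF memB(1)[OF Y(1)]] memB(2)[OF Y(1)] by metis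
    then have "card U + ((r - 1) - card T0) \<le> card ({1..m} - {i, j})"
      using cV[of m] room(2) cT0(1) t by linarith
    moreover have "T0 \<subseteq> U" "card T0 \<le> r - 1"
      using T0B[OF Y(1)] T0V(1) cT0(1) t unfolding U_def by (blast, linarith)
    ultimately obtain R where R: "R \<subseteq> {1..m} - {i, j}" "finite R" "card R = r - 1" "T0 \<subseteq> R" "R \<inter> U = T0"
      using obtain_sunflower_petal[of "{1..m} - {i, j}" T0 U "r - 1"] T0V(1) fU by blast
    have "insert i R \<in> \<A> \<or> insert j R \<in> \<A>"
    proof (rule star_fiber[OF SA _ iT(1)])
      show "i \<in> {1..m}" using iT(1) T(2) by blast
      show "R \<subseteq> {1..m}" "finite R" "i \<notin> R" using R(1,2) by blast+
      show "Suc (card R) = r" using R(3) t by simp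
      show "T - {i} \<subseteq> R" using R(4) unfolding T0_def .
    qed
    moreover have "R \<inter> Y = R \<inter> U" using R(1) unfolding U_def by blast
    ultimately show ?thesis using R by blast
  qed
  from typeA show ?thesis
  proof
    assume all: "\<forall>X\<in>\<A>. T \<subseteq> X"
    have "T \<subseteq> Y" if Y: "Y \<in> \<B>" for Y
    proof (rule ccontr)
      assume nT: "\<not> T \<subseteq> Y"
      note cY = cB[OF Y nT]
      obtain R where R: "R \<subseteq> {1..m} - {i, j}" "R \<inter> Y = T0" "insert i R \<in> \<A> \<or> insert j R \<in> \<A>"
        using petal[OF Y] cY(4) by blast
      have "i \<notin> insert j R" using R(1) ne by blast
      then have "insert i R \<in> \<A>" using R(3) all iT by blast
      moreover have "insert i R \<inter> Y = T0" using R(2) cY(3) by blast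
      ultimately show False using bad Y by blast
    qed
    then show ?thesis using all T(1) unfolding common_kernel_def by blast
  next
    assume all: "\<forall>X\<in>\<A>. j \<in> X"
    have jB: "j \<in> Y" if Y: "Y \<in> \<B>" for Y
    proof (rule ccontr)
      assume nj: "j \<notin> Y"
      then have "i \<in> Y" using cB(4)[OF Y] iT by blast
      then obtain R where R: "R \<subseteq> {1..m} - {i, j}" "R \<inter> Y = T0" "insert i R \<in> \<A> \<or> insert j R \<in> \<A>"
        using petal[OF Y] by blast
      have "j \<notin> insert i R" using R(1) ne by blast
      then have "insert j R \<in> \<A>" using R(3) all by blast
      moreover have "insert j R \<inter> Y = T0" using R(2) nj by blast
      ultimately show False using bad Y by blast
    qed
    have "j \<notin> T0" using iT unfolding T0_def by blast
    then have "card (insert j T0) = t" using cT0 by simp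
    then show ?thesis using all jB T0A T0B unfolding common_kernel_def
      by (intro exI[of _ "insert j T0"]) blast
  qed
qed

section \<open>The maximum product\<close>

lemma stars_cross_intersecting:
  assumes "card T = t"
  shows "cross_intersecting t {X \<in> [V]\<^bsup>r\<^esup>. T \<subseteq> X} {Y \<in> [W]\<^bsup>s\<^esup>. T \<subseteq> Y}"
  unfolding cross_intersecting_def
proof clarify
  fix X Y assume "X \<in> [V]\<^bsup>r\<^esup>" "T \<subseteq> X" "T \<subseteq> Y"
  then have "finite X" "T \<subseteq> X \<inter> Y" by (auto simp: nsets_def)
  then show "t \<le> card (X \<inter> Y)" using assms card_mono[of "X \<inter> Y" T] by auto
qed

text \<open>
  The full stars with centre \<open>T\<close> form an admissible pair, so neither family of a pair of maximum
  product can be a proper part of its star.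
\<close>
lemma max_pair_kernel_exact:
  assumes max: "max_pair t m r n s \<A> \<B>" and ne: "\<A> \<noteq> {}" "\<B> \<noteq> {}"
    and T: "card T = t" "\<forall>X\<in>\<A>. T \<subseteq> X" "\<forall>Y\<in>\<B>. T \<subseteq> Y"
  shows "T \<subseteq> {1..m}" "T \<subseteq> {1..n}"
    "\<A> = {X \<in> [{1..m}]\<^bsup>r\<^esup>. T \<subseteq> X}" "\<B> = {Y \<in> [{1..n}]\<^bsup>s\<^esup>. T \<subseteq> Y}"
proof -
  define SA SB where "SA = {X \<in> [{1..m}]\<^bsup>r\<^esup>. T \<subseteq> X}" and "SB = {Y \<in> [{1..n}]\<^bsup>s\<^esup>. T \<subseteq> Y}"
  have A: "\<A> \<subseteq> [{1..m}]\<^bsup>r\<^esup>" and B: "\<B> \<subseteq> [{1..n}]\<^bsup>s\<^esup>" using max unfolding max_pair_def by blast+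
  obtain X Y where "X \<in> \<A>" "Y \<in> \<B>" using ne by blast
  then show "T \<subseteq> {1..m}" "T \<subseteq> {1..n}" using A B T(2,3) unfolding nsets_def by blast+
  have sub: "\<A> \<subseteq> SA" "\<B> \<subseteq> SB" using A B T(2,3) unfolding SA_def SB_def by blast+
  have SS: "SA \<subseteq> [{1..m}]\<^bsup>r\<^esup>" "SB \<subseteq> [{1..n}]\<^bsup>s\<^esup>" unfolding SA_def SB_def by blast+
  note fin = finite_family[OF SS(1)] finite_family[OF SS(2)]
  have le: "card SA * card SB \<le> card \<A> * card \<B>"
    by (rule max_pair_maximal[OF max SS]) (unfold SA_def SB_def, rule stars_cross_intersecting[OF T(1)])
  have "card \<A> \<le> card SA" "card \<B> \<le> card SB" using sub fin by (intro card_mono; blast)+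
  moreover have "0 < card \<A>" "0 < card \<B>"
    using ne max_pair_finite[OF max] by (simp_all add: card_gt_0_iff)
  ultimately have "card \<A> = card SA" "card \<B> = card SB"
    using le mult_less_le_imp_less[of "card \<A>" "card SA" "card \<B>" "card SB"]
      mult_le_less_imp_less[of "card \<A>" "card SA" "card \<B>" "card SB"]
    by (metis leD le_neq_implies_less zero_le)+
  then show "\<A> = {X \<in> [{1..m}]\<^bsup>r\<^esup>. T \<subseteq> X}" "\<B> = {Y \<in> [{1..n}]\<^bsup>s\<^esup>. T \<subseteq> Y}"
    using card_subset_eq[OF fin(1) sub(1)] card_subset_eq[OF fin(2) sub(2)]
    unfolding SA_def SB_def by blast+
qed

lemma exists_max_pair:
  assumes "\<A> \<subseteq> [{1..m}]\<^bsup>r\<^esup>" "\<B> \<subseteq> [{1..n}]\<^bsup>s\<^esup>" "cross_intersecting t \<A> \<B>"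
  obtains \<A>' \<B>' where "max_pair t m r n s \<A>' \<B>'" "card \<A> * card \<B> \<le> card \<A>' * card \<B>'"
proof -
  define F where "F = {(\<A>', \<B>'). \<A>' \<subseteq> [{1..m}]\<^bsup>r\<^esup> \<and> \<B>' \<subseteq> [{1..n}]\<^bsup>s\<^esup> \<and> cross_intersecting t \<A>' \<B>'}"
  define f where "f = (\<lambda>(\<A>' :: nat set set, \<B>' :: nat set set). card \<A>' * card \<B>')"
  have "F \<subseteq> Pow ([{1..m}]\<^bsup>r\<^esup>) \<times> Pow ([{1..n}]\<^bsup>s\<^esup>)" unfolding F_def by blast
  then have "finite F" by (rule finite_subset) (simp add: finite_imp_finite_nsets)
  moreover have AB: "(\<A>, \<B>) \<in> F" using assms unfolding F_def by blast
  ultimately have fin: "finite (f ` F)" "f ` F \<noteq> {}" by blast+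
  from Max_in[OF this] obtain \<A>' \<B>' where AB': "(\<A>', \<B>') \<in> F" and e: "f (\<A>', \<B>') = Max (f ` F)" by fastforce
  have le: "f p \<le> f (\<A>', \<B>')" if "p \<in> F" for p unfolding e using fin(1) that by (intro Max_ge) blast+
  have "max_pair t m r n s \<A>' \<B>'"
    using AB' le unfolding max_pair_def F_def f_def by fastforce
  then show ?thesis using that le[OF AB] unfolding f_def by simp
qed

lemma shifted_max_pair_common_kernel:
  assumes max: "max_pair t m r n s \<A> \<B>" and sh: "left_shifted \<A>" "left_shifted \<B>"
    and ne: "\<A> \<noteq> {}" "\<B> \<noteq> {}" and t: "1 \<le> t" "t \<le> r" "t \<le> s"
    and L: "real t \<le> L" "6 + 2 * real t < 3 * L"
    and m: "real r + real s - real t + (L + 1) * (real r - real t) \<le> real m + 1" "r + s - t \<le> m"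
    and n: "real r + real s - real t + (L + 1) * (real s - real t) \<le> real n + 1" "r + s - t \<le> n"
    and not_tight: "real t < L \<or>
      ((m - t) choose (r - t)) * ((n - t) choose (s - t)) < card \<A> * card \<B>"
  shows "common_kernel t \<A> \<B>"
proof -
  have A: "\<A> \<subseteq> [{1..m}]\<^bsup>r\<^esup>" and B: "\<B> \<subseteq> [{1..n}]\<^bsup>s\<^esup>" and cr: "cross_intersecting t \<A> \<B>"
    using max unfolding max_pair_def by blast+
  define N where "N = r + s - t"
  have "k \<le> N - t \<Longrightarrow> prefix_cross t (N - k) \<A> \<B>" for k
  proof (induction k)
    case 0
    show ?case using left_shifted_prefix_cross[OF sh(1) A B cr] unfolding N_def by simp
  next
    case (Suc k)
    define l where "l = N - k"
    have lN: "l \<le> N" "t < l" using Suc.prems unfolding l_def by linarith+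
    have rN: "real N = real r + real s - real t" using t unfolding N_def by (simp add: of_nat_diff)
    have lN': "real l \<le> real N" using lN(1) by simp
    have "reducible_max_pair m r n s t l \<A> \<B> L"
    proof (intro reducible_max_pair.intro shifted_max_pair.intro reducible_max_pair_axioms.intro max sh ne L not_tight)
      show "prefix_cross t l \<A> \<B>" unfolding l_def using Suc by simp
      show "1 \<le> t" "t < l" by fact+
      show "l \<le> m" "l \<le> n" using lN(1) m(2) n(2) unfolding N_def by linarith+
      show "real l + (L + 1) * (real r - real t) \<le> real m + 1"
        "real l + (L + 1) * (real s - real t) \<le> real n + 1" using lN' rN m(1) n(1) by linarith+
    qed
    then have "prefix_cross t (l - 1) \<A> \<B>" by (rule reducible_max_pair.prefix_cross_pred)
    then show ?case unfolding l_def by simp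
  qed
  from this[of "N - t"] have pc: "prefix_cross t t \<A> \<B>" using t unfolding N_def by simp
  have all: "{1..t} \<subseteq> X \<inter> Y" if "X \<in> \<A>" "Y \<in> \<B>" for X Y
  proof -
    have "t \<le> card (X \<inter> Y \<inter> {1..t})" using pc that unfolding prefix_cross_def by blast
    then have "X \<inter> Y \<inter> {1..t} = {1..t}" by (intro card_seteq) simp_all
    then show ?thesis by blast
  qed
  have "\<forall>X\<in>\<A>. {1..t} \<subseteq> X" "\<forall>Y\<in>\<B>. {1..t} \<subseteq> Y" using all ne by blast+
  then show ?thesis unfolding common_kernel_def by (intro exI[of _ "{1..t}"]) simp
qed

text \<open>
  Induction on the total weight: a pair that is not left-shifted is compressed, and the kernel
  obtained for the compressed pair is carried back. The assumption \<open>t < s\<close> provides the room for that.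
\<close>
lemma max_pair_common_kernel:
  assumes max: "max_pair t m r n s \<A> \<B>" and ne: "\<A> \<noteq> {}" "\<B> \<noteq> {}"
    and t: "1 \<le> t" "t \<le> r" "r \<le> s" "t < s"
    and L: "real t \<le> L" "6 + 2 * real t < 3 * L"
    and m: "(L + 2) * (real s - real t) + real r \<le> real m + 1"
    and n: "(L + 2) * (real s - real t) + real r \<le> real n + 1"
    and not_tight: "real t < L \<or>
      ((m - t) choose (r - t)) * ((n - t) choose (s - t)) < card \<A> * card \<B>"
  shows "common_kernel t \<A> \<B>"
  using max ne not_tight
proof (induction "weight \<A> + weight \<B>" arbitrary: \<A> \<B> rule: less_induct)
  case less
  have A: "\<A> \<subseteq> [{1..m}]\<^bsup>r\<^esup>" and B: "\<B> \<subseteq> [{1..n}]\<^bsup>s\<^esup>" and cr: "cross_intersecting t \<A> \<B>"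
    using less.prems(1) unfolding max_pair_def by blast+
  define d where "d = s - t"
  have d: "1 \<le> real d" "real d = real s - real t" using t unfolding d_def by (simp_all add: of_nat_diff)
  have L83: "8 / 3 < L" using L t(1) by linarith
  have Ld: "8 / 3 * real d \<le> L * real d" "8 / 3 \<le> L * real d"
  proof -
    show "8 / 3 * real d \<le> L * real d" using L83 by (intro mult_right_mono) simp_all
    then show "8 / 3 \<le> L * real d" using d(1) by linarith
  qed
  have m': "L * real d + 2 * real d + real r \<le> real m + 1" and n': "L * real d + 2 * real d + real r \<le> real n + 1"
    using m n unfolding d(2)[symmetric] by (simp_all add: distrib_right)
  have rs: "real r \<le> real s" "real t \<le> real r" using t by simp_all
  show ?case
  proof (cases "left_shifted \<A> \<and> left_shifted \<B>")
    case True
    have "(L + 1) * (real r - real t) \<le> (L + 1) * real d"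
      using rs d(2) L83 by (intro mult_left_mono) linarith+
    then have m1: "real r + real s - real t + (L + 1) * (real r - real t) \<le> real m + 1"
      using m' d by (simp add: distrib_right)
    have n1: "real r + real s - real t + (L + 1) * (real s - real t) \<le> real n + 1"
      using n' unfolding d(2)[symmetric] using d by (simp add: distrib_right)
    have "real (r + s) \<le> real (m + t)" "real (r + s) \<le> real (n + t)" using m' n' d Ld by simp_all
    then have "r + s - t \<le> m" "r + s - t \<le> n" unfolding of_nat_le_iff by linarith+
    then show ?thesis
      using shifted_max_pair_common_kernel[OF less.prems(1) _ _ less.prems(2,3) t(1,2) _ L m1 _ n1 _ less.prems(4)]
        True t by linarith
  next
    case False
    obtain i j where ij: "1 \<le> i" "i < j"
      and mv: "(\<exists>X\<in>\<A>. shift_set i j \<A> X \<noteq> X) \<or> (\<exists>Y\<in>\<B>. shift_set i j \<B> Y \<noteq> Y)"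
      using False not_left_shifted[of \<A>] not_left_shifted[of \<B>] by metis
    let ?A = "shift_set i j \<A> ` \<A>" and ?B = "shift_set i j \<B> ` \<B>"
    have fA: "finite \<A>" "\<And>X. X \<in> \<A> \<Longrightarrow> finite X" and fB: "finite \<B>" "\<And>X. X \<in> \<B> \<Longrightarrow> finite X"
      using finite_family[OF A] finite_family[OF B] A B unfolding nsets_def by blast+
    have "weight ?A + weight ?B < weight \<A> + weight \<B>"
      using mv
    proof
      assume "\<exists>X\<in>\<A>. shift_set i j \<A> X \<noteq> X"
      then have "weight ?A < weight \<A>" using weight_shift(2)[OF fA ij(2)] by blast
      then show ?thesis using weight_shift(1)[OF fB ij(2)] by linarith
    next
      assume "\<exists>Y\<in>\<B>. shift_set i j \<B> Y \<noteq> Y"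
      then have "weight ?B < weight \<B>" using weight_shift(2)[OF fB ij(2)] by blast
      then show ?thesis using weight_shift(1)[OF fA ij(2)] by linarith
    qed
    moreover have max': "max_pair t m r n s ?A ?B" by (rule shift_max_pair[OF less.prems(1) ij])
    moreover have ne': "?A \<noteq> {}" "?B \<noteq> {}" using less.prems(2,3) by blast+
    ultimately have "common_kernel t ?A ?B"
      using less.prems(4) by (intro less.hyps) (unfold card_shift)
    then obtain T where T: "card T = t" "\<forall>X\<in>?A. T \<subseteq> X" "\<forall>Y\<in>?B. T \<subseteq> Y"
      unfolding common_kernel_def by blast
    note ex = max_pair_kernel_exact[OF max' ne' T]
    have "real (2 * r + s + 1) \<le> real (n + 2 * t)" "real (r + s + 1) \<le> real (m + t)"
      using m' n' d Ld rs by simp_all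
    then have "2 * r + s + 1 \<le> n + 2 * t" "r + s + 1 \<le> m + t" unfolding of_nat_le_iff .
    then show ?thesis
      using unshift_common_kernel[OF A B cr T(1) ex ij t(1,2)] t by linarith
  qed
qed

theorem theorem1p2:
  fixes m n r s t :: nat
    and u :: real
    and \<A> \<B> :: "nat set set"
  assumes "m \<ge> 1" and "n \<ge> 1"
    and "1 \<le> t" and "t \<le> r" and "r \<le> s"
    and "u \<ge> 0" and "u > (6 - real t) / 3"
    and "real (min m n) \<ge> (real t + u + 2) * (real s - real t) + real r - 1"
    and "\<A> \<subseteq> [{1..m}]\<^bsup>r\<^esup>" and "\<B> \<subseteq> [{1..n}]\<^bsup>s\<^esup>"
    and "cross_intersecting t \<A> \<B>"
  shows "card \<A> * card \<B> \<le> ((m - t) choose (r - t)) * ((n - t) choose (s - t))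
    \<and> (u > 0 \<longrightarrow>
        (card \<A> * card \<B> = ((m - t) choose (r - t)) * ((n - t) choose (s - t))
         \<longleftrightarrow> (\<exists>T. T \<subseteq> {1..min m n} \<and> card T = t
               \<and> \<A> = {A \<in> [{1..m}]\<^bsup>r\<^esup>. T \<subseteq> A}
               \<and> \<B> = {B \<in> [{1..n}]\<^bsup>s\<^esup>. T \<subseteq> B})))"
proof -
  let ?bound = "((m - t) choose (r - t)) * ((n - t) choose (s - t))"
  have sA: "card {A \<in> [{1..m}]\<^bsup>r\<^esup>. T \<subseteq> A} = (m - t) choose (r - t)"
    and sB: "card {B \<in> [{1..n}]\<^bsup>s\<^esup>. T \<subseteq> B} = (n - t) choose (s - t)"
    if "T \<subseteq> {1..min m n}" "card T = t" for T
  proof -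
    have "T \<subseteq> {1..m}" "T \<subseteq> {1..n}" using that(1) by auto
    then show "card {A \<in> [{1..m}]\<^bsup>r\<^esup>. T \<subseteq> A} = (m - t) choose (r - t)"
      "card {B \<in> [{1..n}]\<^bsup>s\<^esup>. T \<subseteq> B} = (n - t) choose (s - t)"
      using card_star[of "{1..m}" T r] card_star[of "{1..n}" T s] that(2) assms(4,5) by simp_all
  qed
  have max_kernel: "\<exists>T. card T = t \<and> T \<subseteq> {1..min m n} \<and> \<A>' = {A \<in> [{1..m}]\<^bsup>r\<^esup>. T \<subseteq> A} \<and> \<B>' = {B \<in> [{1..n}]\<^bsup>s\<^esup>. T \<subseteq> B}"
    if max: "max_pair t m r n s \<A>' \<B>'" and ne: "\<A>' \<noteq> {}" "\<B>' \<noteq> {}"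
      and H: "0 < u \<or> ?bound < card \<A>' * card \<B>'" for \<A>' \<B>'
  proof -
    have "common_kernel t \<A>' \<B>'"
    proof (cases "t < s")
      case True
      have "real (min m n) \<le> real m" "real (min m n) \<le> real n" by simp_all
      then have mn: "(real t + u + 2) * (real s - real t) + real r \<le> real m + 1"
        "(real t + u + 2) * (real s - real t) + real r \<le> real n + 1" using assms(8) by linarith+
      show ?thesis
      proof (rule max_pair_common_kernel[OF max ne assms(3-5) True _ _ mn])
        show "real t < real t + u \<or> ?bound < card \<A>' * card \<B>'" using H by simp
      qed (use assms(6,7) in simp_all)
    next
      case False
      then have eq: "r = t" "s = t" using assms(4,5) by simp_all
      have eqXY: "X = Y \<and> finite X \<and> card X = t" if "X \<in> \<A>'" "Y \<in> \<B>'" for X Y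
      proof -
        have "X \<in> [{1..m}]\<^bsup>t\<^esup>" "Y \<in> [{1..n}]\<^bsup>t\<^esup>" "t \<le> card (X \<inter> Y)"
          using max that unfolding eq max_pair_def cross_intersecting_def by blast+
        then have X: "finite X" "card X = t" and Y: "finite Y" "card Y = t" and "t \<le> card (X \<inter> Y)"
          unfolding nsets_def by blast+
        then have "X \<inter> Y = X" "X \<inter> Y = Y" by (intro card_seteq; simp)+
        then show ?thesis using X by simp
      qed
      obtain T where "T \<in> \<A>'" using ne by blast
      then have "card T = t" "\<forall>X\<in>\<A>'. T \<subseteq> X" "\<forall>Y\<in>\<B>'. T \<subseteq> Y" using eqXY ne by blast+
      then show ?thesis unfolding common_kernel_def by blast
    qed
    then obtain T where T: "card T = t" "\<forall>X\<in>\<A>'. T \<subseteq> X" "\<forall>Y\<in>\<B>'. T \<subseteq> Y"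
      unfolding common_kernel_def by blast
    note ex = max_pair_kernel_exact[OF max ne T]
    have "T \<subseteq> {1..min m n}" using ex(1,2) by (simp add: subset_iff)
    then show ?thesis using T(1) ex(3,4) by blast
  qed
  have bound: "card \<A>' * card \<B>' \<le> ?bound" if max: "max_pair t m r n s \<A>' \<B>'" for \<A>' \<B>'
  proof (rule ccontr)
    assume "\<not> ?thesis"
    then have gt: "?bound < card \<A>' * card \<B>'" by simp
    then have "\<A>' \<noteq> {}" "\<B>' \<noteq> {}" by auto
    from max_kernel[OF max this disjI2[OF gt]] sA sB gt show False by force
  qed
  have le: "card \<A> * card \<B> \<le> ?bound"
    using exists_max_pair[OF assms(9-11)] bound by (metis le_trans)
  have "\<exists>T. T \<subseteq> {1..min m n} \<and> card T = t \<and> \<A> = {A \<in> [{1..m}]\<^bsup>r\<^esup>. T \<subseteq> A} \<and> \<B> = {B \<in> [{1..n}]\<^bsup>s\<^esup>. T \<subseteq> B}"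
    if "0 < u" and eq: "card \<A> * card \<B> = ?bound"
  proof -
    have "card \<A>' * card \<B>' \<le> card \<A> * card \<B>"
      if "\<A>' \<subseteq> [{1..m}]\<^bsup>r\<^esup>" "\<B>' \<subseteq> [{1..n}]\<^bsup>s\<^esup>" "cross_intersecting t \<A>' \<B>'" for \<A>' \<B>'
      using exists_max_pair[OF that] bound unfolding eq by (metis le_trans)
    then have max: "max_pair t m r n s \<A> \<B>" using assms(9-11) unfolding max_pair_def by blast
    have "0 < ?bound"
    proof (cases "t < s")
      case True
      have "1 * 1 \<le> (real t + u + 2) * (real s - real t)"
        using True assms(6) by (intro mult_mono) simp_all
      then have "real r \<le> real (min m n)" using assms(8) by linarith
      then have mn: "r \<le> m" "r \<le> n" by simp_all
      have "2 * (real s - real t) + 1 * 1 \<le> 2 * (real s - real t) + (real t + u) * (real s - real t)"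
        using True assms(3,6) by (intro add_left_mono mult_mono) simp_all
      then have "2 * real s - 2 * real t + real r \<le> real (min m n)"
        using assms(8) by (simp add: algebra_simps)
      then have "real s \<le> real n" using assms(4,5) by simp
      then show ?thesis using mn by (simp add: zero_less_binomial diff_le_mono)
    qed (use assms(4,5) in simp)
    then have "\<A> \<noteq> {}" "\<B> \<noteq> {}" using eq by auto
    from max_kernel[OF max this] \<open>0 < u\<close> show ?thesis by blast
  qed
  then show ?thesis using le sA sB by auto
qed

end
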